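(* Let $\mathfrak g=A_{2n}^{(2)\dagger}$ with $n\ge1$, and $1\le r\le n$; put $\mu_r=1$ for $r<n$ and $\mu_n=2$. Then the virtual $U_q'(A_{2n}^{(2)\dagger})$-crystal $V^{r,1}$ is aligned and is isomorphic to $V(\mu_r\overline\Lambda_r)$ as a $U_q(B_n)$-crystal.
   Context: $A_{2n}^{(2)\dagger}$ denotes the affine algebra $A_{2n}^{(2)}$ with its Dynkin diagram labeled so that removing the distinguished vertex $0$ gives $B_n$ (null root $\delta=\alpha_0+2\alpha_1+\cdots+2\alpha_n$). TYPE A CRYSTALS. $\varnothing$ means "undefined"; $\epsilon_i(b)=\max\{m:e_i^m(b)\ne\varnothing\}$, $\varphi_i(b)=\max\{m:f_i^m(b)\ne\varnothing\}$. Tensor convention: $f_i(b_2\otimes b_1)=f_i(b_2)\otimes b_1$ if $\epsilon_i(b_2)\ge\varphi_i(b_1)$ and $b_2\otimes f_i(b_1)$ otherwise; $e_i(b_2\otimes b_1)=e_i(b_2)\otimes b_1$ if $\epsilon_i(b_2)>\varphi_i(b_1)$ and $b_2\otimes e_i(b_1)$ otherwise. Letters are $[2n]$ with $f_i^A(i)=i+1$ ($1\le i\le 2n-1$), all other values $\varnothing$; words are tensor products of letters; a semistandard tableau is identified with its column-reading word $c_1c_2\cdots$, $c_j$ being the strictly decreasing word of the $j$-th column. $B_A^{r,1}$ is the set of strictly decreasing words (columns) of length $r$ in $[2n]$; on it $f_0^A$ removes the letter $2n$ and adds the letter $1$ when $2n$ occurs and $1$ does not (and is $\varnothing$ otherwise),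 and $e_0^A$ is the inverse; extend to tensor products by the tensor rule. VIRTUAL CRYSTALS of type $A_{2n}^{(2)\dagger}$. Virtual operators: $e_0=(e_0^A)^2$, $e_i=e_{2n-i}^Ae_i^A$ ($1\le i\le n-1$), $e_n=e_n^A$, and similarly $f_i$. Virtual weight: $\Psi(\mathrm{wt}(b))=\mathrm{wt}_A(b)$, where $\Psi(\overline\Lambda_i)=\overline\Lambda_i^A+\overline\Lambda_{2n-i}^A$ for $i<n$ and $\Psi(\overline\Lambda_n)=\overline\Lambda_n^A$ ($\overline\Lambda_i,\overline\Lambda_i^A$ the fundamental weights of $B_n$, $A_{2n-1}$). Ambient crystal: $\widehat V^{r,1}=B_A^{2n-r,1}\otimes B_A^{r,1}$ for $1\le r\le n$. $V^{r,1}\subset\widehat V^{r,1}$ is the subset generated by the virtual operators $e_i,f_i$, $0\le i\le n$, from $\bigl((2n-r)\cdots21\bigr)\otimes\bigl(r\cdots21\bigr)$. $V(\mu_r\overline\Lambda_r)$ is the subset of the crystal of semistandard tableaux in $[2n]$ with two columns of heights $2n-r$ and $r$ (viewed inside $\widehat V^{r,1}$ by $uv\mapsto u\otimes v$) generated by the virtual operators $e_i,f_i$ with $1\le i\le n$ only, from the tableau whose $i$-th row consists of letters $i$; it is isomorphic to the crystal $B(\mu_r\overline\Lambda_r)$ of the irreducible $U_q(B_n)$-module of highest weight $\mu_r\overline\Lambda_r$ (Baker). $V^{r,1}$ is aligned if for all $b\in V^{r,1}$: $\varphi_i^A(b)=\varphi_{2n-i}^A(b)$ and $\epsilon_i^A(b)=\epsilon_{2n-i}^A(b)$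 for $1\le i\le n-1$, and $\varphi_0^A(b),\epsilon_0^A(b)$ are even. *)

theory Defs
  imports Main
begin

text \<open>The symbol \<open>\<emptyset>\<close> (``undefined'') is \<^const>\<open>None\<close>. Weights are coefficient functions
  with respect to the fundamental weights.\<close>

record ('b, 'w) crystal =
  carrier :: "'b set"
  eop :: "nat \<Rightarrow> 'b \<Rightarrow> 'b option"
  fop :: "nat \<Rightarrow> 'b \<Rightarrow> 'b option"
  wt :: "'b \<Rightarrow> 'w"

type_synonym weight = "nat \<Rightarrow> int"

primrec iter :: "('b \<Rightarrow> 'b option) \<Rightarrow> nat \<Rightarrow> 'b \<Rightarrow> 'b option" where
  "iter g 0 b = Some b"
| "iter g (Suc m) b = Option.bind (iter g m b) g"

definition depth :: "('b \<Rightarrow> 'b option) \<Rightarrow> 'b \<Rightarrow> nat" where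
  "depth g b = Max {m. iter g m b \<noteq> None}"

definition epsilon :: "('b, 'w) crystal \<Rightarrow> nat \<Rightarrow> 'b \<Rightarrow> nat" where
  "epsilon C i b = depth (eop C i) b"

definition phi :: "('b, 'w) crystal \<Rightarrow> nat \<Rightarrow> 'b \<Rightarrow> nat" where
  "phi C i b = depth (fop C i) b"


subsection \<open>Type A crystals\<close>

text \<open>The element \<open>b\<^sub>2 \<otimes> b\<^sub>1\<close> is the pair \<open>(b\<^sub>2, b\<^sub>1)\<close>.\<close>

definition tensor ::
  "('b, weight) crystal \<Rightarrow> ('c, weight) crystal \<Rightarrow> ('b \<times> 'c, weight) crystal" where
  "tensor C2 C1 =
    \<lparr> carrier = carrier C2 \<times> carrier C1,
      eop = (\<lambda>i (b2, b1).
        if epsilon C2 i b2 > phi C1 i b1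
        then map_option (\<lambda>c. (c, b1)) (eop C2 i b2)
        else map_option (\<lambda>c. (b2, c)) (eop C1 i b1)),
      fop = (\<lambda>i (b2, b1).
        if epsilon C2 i b2 \<ge> phi C1 i b1
        then map_option (\<lambda>c. (c, b1)) (fop C2 i b2)
        else map_option (\<lambda>c. (b2, c)) (fop C1 i b1)),
      wt = (\<lambda>(b2, b1) i. wt C2 b2 i + wt C1 b1 i) \<rparr>"

text \<open>The letter \<open>a\<close> has the \<open>A\<^bsub>2n-1\<^esub>\<close>-weight \<open>\<Lambda>\<^sub>a - \<Lambda>\<^bsub>a-1\<^esub>\<close>, where \<open>\<Lambda>\<^sub>0\<close> and
  \<open>\<Lambda>\<^bsub>2n\<^esub>\<close> are zero.\<close>

definition letters :: "nat \<Rightarrow> (nat, weight) crystal" where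
  "letters n =
    \<lparr> carrier = {1..2 * n},
      eop = (\<lambda>i a. if i \<in> {1..2 * n - 1} \<and> a = i + 1 then Some i else None),
      fop = (\<lambda>i a. if i \<in> {1..2 * n - 1} \<and> a = i then Some (i + 1) else None),
      wt = (\<lambda>a i. if i \<in> {1..2 * n - 1} then of_bool (a = i) - of_bool (a = i + 1) else 0) \<rparr>"

text \<open>Words of length \<open>k\<close> form the \<open>k\<close>-fold tensor power of the letters, with
  \<open>a # w\<close> standing for \<open>a \<otimes> w\<close>. The empty word spans the trivial crystal, which is a
  unit for the tensor product.\<close>

primrec words :: "nat \<Rightarrow> nat \<Rightarrow> (nat list, weight) crystal" where
  "words n 0 =
    \<lparr> carrier = {[]}, eop = (\<lambda>i w. None), fop = (\<lambda>i w. None), wt = (\<lambda>w i. 0) \<rparr>"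
| "words n (Suc k) =
    (let T = tensor (letters n) (words n k); cons = (\<lambda>(a, w). a # w) in
    \<lparr> carrier = cons ` carrier T,
      eop = (\<lambda>i w. map_option cons (eop T i (hd w, tl w))),
      fop = (\<lambda>i w. map_option cons (fop T i (hd w, tl w))),
      wt = (\<lambda>w. wt T (hd w, tl w)) \<rparr>)"

definition columns :: "nat \<Rightarrow> nat \<Rightarrow> nat list set" where
  "columns n r = {w. length w = r \<and> set w \<subseteq> {1..2 * n} \<and> sorted_wrt (>) w}"

definition column_e0 :: "nat \<Rightarrow> nat list \<Rightarrow> nat list option" where
  "column_e0 n w =
    (if 1 \<in> set w \<and> 2 * n \<notin> set w then Some ((2 * n) # removeAll 1 w) else None)"

definition column_f0 :: "nat \<Rightarrow> nat list \<Rightarrow> nat list option" where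
  "column_f0 n w =
    (if 2 * n \<in> set w \<and> 1 \<notin> set w then Some (removeAll (2 * n) w @ [1]) else None)"

text \<open>The crystal \<open>B\<^sub>A\<^bsup>r,1\<^esup>\<close>; its weight function is the classical one.\<close>

definition column_crystal :: "nat \<Rightarrow> nat \<Rightarrow> (nat list, weight) crystal" where
  "column_crystal n r =
    \<lparr> carrier = columns n r,
      eop = (\<lambda>i. if i = 0 then column_e0 n else eop (words n r) i),
      fop = (\<lambda>i. if i = 0 then column_f0 n else fop (words n r) i),
      wt = wt (words n r) \<rparr>"

text \<open>Semistandard tableaux with two columns of heights \<open>2n-r\<close> and \<open>r\<close>, as column-reading
  words \<open>u @ v\<close>. Columns are read from bottom to top, so row \<open>k\<close> (counted from the top)
  contains the \<open>k\<close>-th entries of \<open>rev u\<close> and \<open>rev v\<close>.\<close>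

definition two_column_tableaux :: "nat \<Rightarrow> nat \<Rightarrow> nat list set" where
  "two_column_tableaux n r =
    {u @ v | u v. u \<in> columns n (2 * n - r) \<and> v \<in> columns n r \<and>
                  (\<forall>k<r. rev u ! k \<le> rev v ! k)}"

definition tableau_crystal :: "nat \<Rightarrow> nat \<Rightarrow> (nat list, weight) crystal" where
  "tableau_crystal n r = (words n (2 * n))\<lparr> carrier := two_column_tableaux n r \<rparr>"


subsection \<open>Virtual crystals of type \<open>A\<^bsub>2n\<^esub>\<^bsup>(2)\<dagger>\<^esup>\<close>\<close>

definition fund :: "nat \<Rightarrow> weight" where
  "fund i = (\<lambda>j. of_bool (j = i))"

definition B_weights :: "nat \<Rightarrow> weight set" where
  "B_weights n = {\<nu>. \<forall>i. i \<notin> {1..n} \<longrightarrow> \<nu> i = 0}"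

definition Psi :: "nat \<Rightarrow> weight \<Rightarrow> weight" where
  "Psi n \<nu> =
    (\<lambda>j. \<Sum>i = 1..n. \<nu> i * (if i < n then fund i j + fund (2 * n - i) j else fund n j))"

text \<open>Since \<open>\<Psi>\<close> is injective but not surjective, the virtual weight is a partial function.\<close>

definition virtual_wt :: "nat \<Rightarrow> ('b, weight) crystal \<Rightarrow> 'b \<Rightarrow> weight option" where
  "virtual_wt n A b =
    (if \<exists>!\<nu>. \<nu> \<in> B_weights n \<and> Psi n \<nu> = wt A b
     then Some (THE \<nu>. \<nu> \<in> B_weights n \<and> Psi n \<nu> = wt A b) else None)"

definition virtual_op :: "nat \<Rightarrow> (nat \<Rightarrow> 'b \<Rightarrow> 'b option) \<Rightarrow> nat \<Rightarrow> 'b \<Rightarrow> 'b option" where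
  "virtual_op n g i b =
    (if i = 0 then iter (g 0) 2 b
     else if i < n then Option.bind (g i b) (g (2 * n - i))
     else if i = n then g n b
     else None)"

definition virtual :: "nat \<Rightarrow> ('b, weight) crystal \<Rightarrow> ('b, weight option) crystal" where
  "virtual n A =
    \<lparr> carrier = carrier A,
      eop = virtual_op n (eop A),
      fop = virtual_op n (fop A),
      wt = virtual_wt n A \<rparr>"

text \<open>No membership of \<open>c\<close> in the carrier is demanded: the operators used below preserve the
  columns and the semistandard tableaux.\<close>

inductive_set generated :: "('b, 'w) crystal \<Rightarrow> nat set \<Rightarrow> 'b \<Rightarrow> 'b set"
  for C :: "('b, 'w) crystal" and I :: "nat set" and b0 :: 'b where
  start: "b0 \<in> generated C I b0"
| eop: "b \<in> generated C I b0 \<Longrightarrow> i \<in> I \<Longrightarrow> eop C i b = Some c \<Longrightarrow> c \<in> generated C I b0"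
| fop: "b \<in> generated C I b0 \<Longrightarrow> i \<in> I \<Longrightarrow> fop C i b = Some c \<Longrightarrow> c \<in> generated C I b0"

definition top_column :: "nat \<Rightarrow> nat list" where
  "top_column h = rev [1..<h + 1]"

definition ambient :: "nat \<Rightarrow> nat \<Rightarrow> (nat list \<times> nat list, weight) crystal" where
  "ambient n r = tensor (column_crystal n (2 * n - r)) (column_crystal n r)"

text \<open>The virtual crystal \<open>V\<^bsup>r,1\<^esup>\<close>.\<close>

definition V_aff :: "nat \<Rightarrow> nat \<Rightarrow> (nat list \<times> nat list, weight option) crystal" where
  "V_aff n r = (virtual n (ambient n r))
    \<lparr> carrier := generated (virtual n (ambient n r)) {0..n}
                  (top_column (2 * n - r), top_column r) \<rparr>"

text \<open>The \<open>B\<^sub>n\<close>-crystal \<open>V(\<mu>\<^sub>r \<Lambda>\<^sub>r)\<close>, generated by the tableau whose \<open>i\<close>-th row consists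
  of letters \<open>i\<close>. That \<open>\<mu>\<^sub>r \<Lambda>\<^sub>r\<close> is the weight of this tableau is shown below.\<close>

definition V_fin :: "nat \<Rightarrow> nat \<Rightarrow> (nat list, weight option) crystal" where
  "V_fin n r = (virtual n (tableau_crystal n r))
    \<lparr> carrier := generated (virtual n (tableau_crystal n r)) {1..n}
                  (top_column (2 * n - r) @ top_column r) \<rparr>"

text \<open>Alignment refers to the type A statistics of the ambient crystal.\<close>

definition aligned :: "nat \<Rightarrow> ('b, weight) crystal \<Rightarrow> 'b set \<Rightarrow> bool" where
  "aligned n A V \<longleftrightarrow>
    (\<forall>b\<in>V. (\<forall>i\<in>{1..n - 1}. phi A i b = phi A (2 * n - i) b \<and>
                            epsilon A i b = epsilon A (2 * n - i) b) \<and>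
            even (phi A 0 b) \<and> even (epsilon A 0 b))"

text \<open>An isomorphism of \<open>B\<^sub>n\<close>-crystals; in particular, all weights are required to be
  defined.\<close>

definition B_crystal_iso ::
  "nat \<Rightarrow> ('b, weight option) crystal \<Rightarrow> ('c, weight option) crystal \<Rightarrow> ('b \<Rightarrow> 'c) \<Rightarrow> bool" where
  "B_crystal_iso n C D h \<longleftrightarrow>
    bij_betw h (carrier C) (carrier D) \<and>
    (\<forall>b\<in>carrier C.
      (\<exists>\<nu>. wt C b = Some \<nu> \<and> wt D (h b) = Some \<nu>) \<and>
      (\<forall>i\<in>{1..n}.
        epsilon D i (h b) = epsilon C i b \<and>
        phi D i (h b) = phi C i b \<and>
        eop D i (h b) = map_option h (eop C i b) \<and>
        fop D i (h b) = map_option h (fop C i b)))"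

definition B_crystals_isomorphic ::
  "nat \<Rightarrow> ('b, weight option) crystal \<Rightarrow> ('c, weight option) crystal \<Rightarrow> bool" where
  "B_crystals_isomorphic n C D \<longleftrightarrow> (\<exists>h. B_crystal_iso n C D h)"


subsection \<open>The generating tableau\<close>

lemma wt_words:
  assumes "length w = k"
  shows "wt (words n k) w i = (\<Sum>a\<leftarrow>w. wt (letters n) a i)"
  using assms
proof (induction k arbitrary: w)
  case (Suc k)
  then show ?case by (cases w) (simp_all add: Let_def tensor_def)
qed simp

lemma wt_top_column:
  "h \<le> 2 * n \<Longrightarrow> (\<Sum>a\<leftarrow>top_column h. wt (letters n) a i) =
     of_bool (i = h \<and> i \<in> {1..2 * n - 1})"
  by (induction h) (auto simp: top_column_def letters_def)

lemma Psi_inj: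
  assumes "\<nu> \<in> B_weights n" "\<nu>' \<in> B_weights n" "Psi n \<nu> = Psi n \<nu>'"
  shows "\<nu> = \<nu>'"
proof
  have Psi_apply: "Psi n \<kappa> j = \<kappa> j" if "j \<in> {1..n}" for \<kappa> j
  proof -
    have "Psi n \<kappa> j = (\<Sum>i = 1..n. if i = j then \<kappa> i else 0)"
      unfolding Psi_def using that by (intro sum.cong) (auto simp: fund_def)
    then show ?thesis using that by simp
  qed
  fix j
  show "\<nu> j = \<nu>' j"
  proof (cases "j \<in> {1..n}")
    case True
    then show ?thesis using Psi_apply[of j \<nu>] Psi_apply[of j \<nu>'] assms(3) by simp
  next
    case False
    then show ?thesis using assms(1,2) by (auto simp: B_weights_def)
  qed
qed

lemma top_column_in_columns: "h \<le> 2 * n \<Longrightarrow> top_column h \<in> columns n h"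
  by (auto simp: top_column_def columns_def sorted_wrt_rev simp del: upt_Suc)

lemma top_tableau:
  assumes "1 \<le> r" "r \<le> n"
  shows "top_column (2 * n - r) @ top_column r \<in> two_column_tableaux n r"
proof -
  have "\<forall>k<r. rev (top_column (2 * n - r)) ! k \<le> rev (top_column r) ! k"
    using assms by (auto simp: top_column_def simp del: upt_Suc)
  then show ?thesis
    unfolding two_column_tableaux_def mem_Collect_eq
    using assms
    by (intro exI[of _ "top_column (2 * n - r)"] exI[of _ "top_column r"] conjI)
      (simp_all add: top_column_in_columns)
qed

lemma virtual_wt_top:
  assumes "1 \<le> r" "r \<le> n"
  shows "wt (V_fin n r) (top_column (2 * n - r) @ top_column r) =
    Some (\<lambda>i. (if r < n then 1 else 2) * fund r i)"
proof -
  let ?w = "top_column (2 * n - r) @ top_column r"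
  let ?l = "\<lambda>i. (if r < n then 1 else 2) * fund r i"
  have hr: "1 \<le> 2 * n - r" "2 * n - r \<le> 2 * n - 1" using assms by linarith+
  have len: "length ?w = 2 * n" using assms by (simp add: top_column_def)
  have wtw: "wt (tableau_crystal n r) ?w = Psi n ?l"
  proof
    fix j
    have "wt (tableau_crystal n r) ?w j =
      of_bool (j = 2 * n - r \<and> j \<in> {1..2 * n - 1}) + of_bool (j = r \<and> j \<in> {1..2 * n - 1})"
      using assms len wt_top_column[of "2 * n - r" n j] wt_top_column[of r n j]
      by (simp add: tableau_crystal_def wt_words)
    moreover have "Psi n ?l j =
      (\<Sum>i = 1..n. if i = r then (if r < n then fund r j + fund (2 * n - r) j else 2 * fund n j)
                    else 0)"
      unfolding Psi_def by (intro sum.cong) (auto simp: fund_def)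
    ultimately show "wt (tableau_crystal n r) ?w j = Psi n ?l j"
      using assms hr by (auto simp: fund_def)
  qed
  have B: "?l \<in> B_weights n" using assms by (auto simp: B_weights_def fund_def)
  have uniq: "\<nu> = ?l" if "\<nu> \<in> B_weights n \<and> Psi n \<nu> = Psi n ?l" for \<nu>
    using Psi_inj[OF conjunct1[OF that] B conjunct2[OF that]] .
  have "\<exists>!\<nu>. \<nu> \<in> B_weights n \<and> Psi n \<nu> = Psi n ?l"
    using uniq B by (intro ex1I[of _ ?l]) iprover+
  moreover have "(THE \<nu>. \<nu> \<in> B_weights n \<and> Psi n \<nu> = Psi n ?l) = ?l"
    using uniq B by (intro the_equality) iprover+
  ultimately show ?thesis
    unfolding V_fin_def virtual_def virtual_wt_def by (simp add: wtw)
qed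

end

theory Submission
  imports Defs
begin

text \<open>For a pair \<open>u \<otimes> v\<close> of columns and \<open>1 \<le> k \<le> n\<close>, record which of the letters \<open>k\<close> and
  \<open>k' = 2n + 1 - k\<close> occur in \<open>u\<close> and in \<open>v\<close>. Of the sixteen possibilities only five matter,
  called the \<^emph>\<open>site\<close> at \<open>k\<close>:

  \<^item> \<open>Hole\<close>: both letters in \<open>u\<close>, none in \<open>v\<close>;
  \<^item> \<open>Plus\<close>: \<open>k\<close> in both columns, \<open>k'\<close> in none; \<open>Minus\<close>: the same with \<open>k\<close>, \<open>k'\<close> exchanged;
  \<^item> \<open>Open\<close>: \<open>k\<close> in \<open>u\<close> and \<open>k'\<close> in \<open>v\<close>; \<open>Close\<close>: \<open>k'\<close> in \<open>u\<close> and \<open>k\<close> in \<open>v\<close>.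

  In each of them the letters \<open>k\<close> and \<open>k'\<close> occur exactly twice together, which makes the weight
  symmetric and hence an image under \<open>\<Psi>\<close>.

  On sites the virtual operators are transparent. For \<open>i < n\<close> the operator \<open>f\<^sub>i\<close> changes the
  sites \<open>i\<close> and \<open>i + 1\<close> only: a \<open>Plus\<close> moves to the right and a \<open>Minus\<close> to the left, past any
  neutral site, and \<open>Plus Minus\<close> becomes \<open>Open Close\<close>, which becomes \<open>Minus Plus\<close>. At the last site,
  \<open>f\<^sub>n\<close> turns \<open>Plus\<close> into \<open>Open\<close> and \<open>Open\<close> into \<open>Minus\<close>. At the first site, \<open>f\<^sub>0\<close> turns \<open>Minus\<close>
  into \<open>Plus\<close>. The only neighbours at which alignment fails are \<open>Hole Close\<close> and \<open>Open Hole\<close>, and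
  the only first site at which \<open>\<epsilon>\<^sub>0\<close> and \<open>\<phi>\<^sub>0\<close> are odd is \<open>Close\<close>.

  Read \<open>Open\<close> and \<open>Close\<close> as brackets, and call a sequence of sites \<^emph>\<open>legal\<close> if no \<open>Close\<close> is
  unmatched and no \<open>Open\<close> before a \<open>Hole\<close> is still unmatched there. Legality excludes the three bad
  configurations (\<open>legal_adjacent\<close>, \<open>legal_not_Close_first\<close>) and survives all moves
  (\<open>legal_pair_move\<close>, \<open>legal_replace_last\<close>, \<open>legal_replace_sign\<close>). Therefore the legal pairs are closed under all virtual operators and aligned; the generator of \<open>V\<^bsup>r,1\<^esup>\<close> is the legal
  sequence of \<open>r\<close> times \<open>Plus\<close> followed by \<open>Hole\<close>s. Conversely, each \<open>e\<^sub>i\<close> with \<open>i \<ge> 1\<close> lowers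
  the sum of the letters, and a legal pair that all of them kill is the generator
  (\<open>highest_is_top\<close>). So every legal pair is reached from the generator without using the index \<open>0\<close>:
  generating with \<open>0,\<dots>,n\<close> and with \<open>1,\<dots>,n\<close> gives the same set, the legal pairs
  (\<open>generated_eq_legal_pairs\<close>).

  It remains to pass from \<open>u \<otimes> v\<close> to the word \<open>uv\<close>. The tensor product is associative
  (\<open>word_ops_append\<close>), so concatenation intertwines all type A operators with nonzero index, and with
  them the virtual operators, their depths, the weights and the generated sets.\<close>

section \<open>Seminormality and tensor products\<close>

text \<open>The counters \<open>ep\<close> and \<open>ph\<close> are explicit functions, to be identified with the depths of \<open>e\<close> and
  \<open>f\<close>. The domain \<open>D\<close> is needed because the operators on words and columns have no meaning on
  lists of the wrong shape.\<close>

definition seminormal_on ::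
  "'b set \<Rightarrow> ('b \<Rightarrow> 'b option) \<Rightarrow> ('b \<Rightarrow> 'b option) \<Rightarrow> ('b \<Rightarrow> nat) \<Rightarrow> ('b \<Rightarrow> nat) \<Rightarrow> bool" where
  "seminormal_on D e f ep ph \<longleftrightarrow> (\<forall>b\<in>D.
     (e b = None \<longleftrightarrow> ep b = 0) \<and> (f b = None \<longleftrightarrow> ph b = 0) \<and>
     (\<forall>c. e b = Some c \<longrightarrow> c \<in> D \<and> ep b = Suc (ep c) \<and> ph c = Suc (ph b)) \<and>
     (\<forall>c. f b = Some c \<longrightarrow> c \<in> D \<and> ph b = Suc (ph c) \<and> ep c = Suc (ep b)))"

lemma seminormal_onI:
  assumes "\<And>b. b \<in> D \<Longrightarrow> e b = None \<longleftrightarrow> ep b = 0"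
    and "\<And>b. b \<in> D \<Longrightarrow> f b = None \<longleftrightarrow> ph b = 0"
    and "\<And>b c. b \<in> D \<Longrightarrow> e b = Some c \<Longrightarrow> c \<in> D \<and> ep b = Suc (ep c) \<and> ph c = Suc (ph b)"
    and "\<And>b c. b \<in> D \<Longrightarrow> f b = Some c \<Longrightarrow> c \<in> D \<and> ph b = Suc (ph c) \<and> ep c = Suc (ep b)"
  shows "seminormal_on D e f ep ph"
  unfolding seminormal_on_def using assms by blast

lemma depth_eqI:
  assumes none: "\<And>b. b \<in> D \<Longrightarrow> g b = None \<longleftrightarrow> d b = 0"
    and some: "\<And>b c. b \<in> D \<Longrightarrow> g b = Some c \<Longrightarrow> c \<in> D \<and> d b = Suc (d c)"
    and b: "b \<in> D"
  shows "depth g b = d b"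
proof -
  have "if m \<le> d b then \<exists>c\<in>D. iter g m b = Some c \<and> d c = d b - m else iter g m b = None" for m
  proof (induction m)
    case 0
    then show ?case using b by simp
  next
    case (Suc m)
    show ?case
    proof (cases "m \<le> d b")
      case True
      then obtain c where c: "c \<in> D" "iter g m b = Some c" "d c = d b - m"
        using Suc by auto
      show ?thesis
      proof (cases "g c")
        case None
        then have "\<not> Suc m \<le> d b" using none[OF c(1)] c(3) by simp
        then show ?thesis using None c by simp
      next
        case (Some c')
        then have "c' \<in> D" "d c = Suc (d c')" using some[OF c(1)] by auto
        then have "Suc m \<le> d b" "d c' = d b - Suc m" using c(3) by linarith+
        then show ?thesis using \<open>c' \<in> D\<close> Some c by simp
      qed
    next
      case False
      then show ?thesis using Suc by simp
    qed
  qed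
  then have "iter g m b \<noteq> None \<longleftrightarrow> m \<le> d b" for m by (metis option.distinct(1))
  then have "{m. iter g m b \<noteq> None} = {..d b}" by auto
  then show ?thesis by (simp add: depth_def Max_eq_iff)
qed

lemma seminormal_onD:
  assumes "seminormal_on D e f ep ph" "b \<in> D"
  shows "e b = None \<longleftrightarrow> ep b = 0" "f b = None \<longleftrightarrow> ph b = 0"
    "\<And>c. e b = Some c \<Longrightarrow> c \<in> D \<and> ep b = Suc (ep c) \<and> ph c = Suc (ph b)"
    "\<And>c. f b = Some c \<Longrightarrow> c \<in> D \<and> ph b = Suc (ph c) \<and> ep c = Suc (ep b)"
  using assms unfolding seminormal_on_def by blast+

lemma seminormal_on_depth:
  assumes "seminormal_on D e f ep ph" "b \<in> D"
  shows "depth e b = ep b" "depth f b = ph b"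
proof -
  note S = seminormal_onD[OF assms(1)]
  show "depth e b = ep b" by (rule depth_eqI[OF S(1) _ assms(2)]) (use S(3) in blast)+
  show "depth f b = ph b" by (rule depth_eqI[OF S(2) _ assms(2)]) (use S(4) in blast)+
qed

text \<open>Each unit of \<open>\<phi>\<close> of the right factor cancels one unit of \<open>\<epsilon>\<close> of the left factor. The tensor rule
  lets an operator act on exactly that factor where its counter is not exhausted by the
  cancellation, so the counters of the product again change by one.\<close>

lemma seminormal_on_tensor:
  assumes 2: "seminormal_on D2 (eop C2 i) (fop C2 i) ep2 ph2"
    and 1: "seminormal_on D1 (eop C1 i) (fop C1 i) ep1 ph1"
  shows "seminormal_on (D2 \<times> D1) (eop (tensor C2 C1) i) (fop (tensor C2 C1) i)
    (\<lambda>(b2, b1). ep1 b1 + (ep2 b2 - ph1 b1)) (\<lambda>(b2, b1). ph2 b2 + (ph1 b1 - ep2 b2))"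
proof -
  have d: "\<And>b. b \<in> D2 \<Longrightarrow> epsilon C2 i b = ep2 b" "\<And>b. b \<in> D1 \<Longrightarrow> phi C1 i b = ph1 b"
    using seminormal_on_depth[OF 2] seminormal_on_depth[OF 1] by (auto simp: epsilon_def phi_def)
  let ?e = "eop (tensor C2 C1) i" and ?f = "fop (tensor C2 C1) i"
  let ?ep = "\<lambda>(b2, b1). ep1 b1 + (ep2 b2 - ph1 b1)"
  let ?ph = "\<lambda>(b2, b1). ph2 b2 + (ph1 b1 - ep2 b2)"
  have e: "?e (x, y) = (if ep2 x > ph1 y then map_option (\<lambda>c. (c, y)) (eop C2 i x)
        else map_option (\<lambda>c. (x, c)) (eop C1 i y))"
    and f: "?f (x, y) = (if ep2 x \<ge> ph1 y then map_option (\<lambda>c. (c, y)) (fop C2 i x)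
        else map_option (\<lambda>c. (x, c)) (fop C1 i y))" if "x \<in> D2" "y \<in> D1" for x y
    using d that by (simp_all add: tensor_def)
  show ?thesis
  proof (rule seminormal_onI; (unfold split_paired_all mem_Sigma_iff, elim conjE))
    fix x y assume x: "x \<in> D2" and y: "y \<in> D1"
    note X = seminormal_onD[OF 2 x] and Y = seminormal_onD[OF 1 y]
    show "?e (x, y) = None \<longleftrightarrow> ?ep (x, y) = 0" "?f (x, y) = None \<longleftrightarrow> ?ph (x, y) = 0"
      unfolding e[OF x y] f[OF x y] using X(1,2) Y(1,2) by auto
    fix x' y'
    show "(x' \<in> D2 \<and> y' \<in> D1) \<and> ?ep (x, y) = Suc (?ep (x', y')) \<and> ?ph (x', y') = Suc (?ph (x, y))"
      if "?e (x, y) = Some (x', y')"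
    proof (cases "ep2 x > ph1 y")
      case True
      with that e[OF x y] have "eop C2 i x = Some x'" "y' = y" by auto
      with X(3) y True show ?thesis by fastforce
    next
      case False
      with that e[OF x y] have "eop C1 i y = Some y'" "x' = x" by auto
      with Y(3) x False show ?thesis by fastforce
    qed
    show "(x' \<in> D2 \<and> y' \<in> D1) \<and> ?ph (x, y) = Suc (?ph (x', y')) \<and> ?ep (x', y') = Suc (?ep (x, y))"
      if "?f (x, y) = Some (x', y')"
    proof (cases "ep2 x \<ge> ph1 y")
      case True
      with that f[OF x y] have "fop C2 i x = Some x'" "y' = y" by auto
      with X(4) y True show ?thesis by fastforce
    next
      case False
      with that f[OF x y] have "fop C1 i y = Some y'" "x' = x" by auto
      with Y(4) x False show ?thesis by fastforce
    qed
  qed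
qed

section \<open>Words\<close>

text \<open>The depths of \<open>e\<^sub>i\<close> and \<open>f\<^sub>i\<close> on a word, by the signature rule: the letter \<open>i + 1\<close> contributes to
  \<open>\<epsilon>\<close>, the letter \<open>i\<close> to \<open>\<phi>\<close>, and an \<open>i + 1\<close> cancels with an \<open>i\<close> to its right.\<close>

fun weps :: "nat \<Rightarrow> nat list \<Rightarrow> nat" and wphi :: "nat \<Rightarrow> nat list \<Rightarrow> nat" where
  "weps i [] = 0"
| "weps i (a # w) = weps i w + (of_bool (a = Suc i) - wphi i w)"
| "wphi i [] = 0"
| "wphi i (a # w) = of_bool (a = i) + (wphi i w - of_bool (a = Suc i))"

lemma seminormal_on_letters:
  assumes "i \<in> {1..2 * n - 1}"
  shows "seminormal_on UNIV (eop (letters n) i) (fop (letters n) i)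
    (\<lambda>a. of_bool (a = Suc i)) (\<lambda>a. of_bool (a = i))"
  using assms by (auto simp: seminormal_on_def letters_def)

lemma seminormal_on_words:
  assumes i: "i \<in> {1..2 * n - 1}"
  shows "seminormal_on {w. length w = k} (eop (words n k) i) (fop (words n k) i) (weps i) (wphi i)"
proof (induction k)
  case 0
  then show ?case by (simp add: seminormal_on_def)
next
  case (Suc k)
  note T = seminormal_on_tensor[OF seminormal_on_letters[OF i] Suc]
  have tens: "eop (words n (Suc k)) i (a # x) = map_option (\<lambda>(a, w). a # w) (eop (tensor (letters n) (words n k)) i (a, x))"
    "fop (words n (Suc k)) i (a # x) = map_option (\<lambda>(a, w). a # w) (fop (tensor (letters n) (words n k)) i (a, x))"
    for a x by (simp_all add: Let_def)
  show ?case
  proof (rule seminormal_onI)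
    fix w :: "nat list" assume "w \<in> {w. length w = Suc k}"
    then obtain a x where w: "w = a # x" and x: "length x = k" by (auto simp: length_Suc_conv)
    then have "(a, x) \<in> UNIV \<times> {w. length w = k}" by simp
    note TD = seminormal_onD[OF T this]
    show "eop (words n (Suc k)) i w = None \<longleftrightarrow> weps i w = 0"
      "fop (words n (Suc k)) i w = None \<longleftrightarrow> wphi i w = 0"
      unfolding w tens using TD(1,2) by auto
    fix c
    show "c \<in> {w. length w = Suc k} \<and> weps i w = Suc (weps i c) \<and>
        wphi i c = Suc (wphi i w)"
      if c: "eop (words n (Suc k)) i w = Some c"
    proof -
      obtain a' x' where "eop (tensor (letters n) (words n k)) i (a, x) = Some (a', x')" "c = a' # x'"
        using c unfolding w tens by auto
      then show ?thesis unfolding w using TD(3) by auto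
    qed
    show "c \<in> {w. length w = Suc k} \<and> wphi i w = Suc (wphi i c) \<and>
        weps i c = Suc (weps i w)"
      if c: "fop (words n (Suc k)) i w = Some c"
    proof -
      obtain a' x' where "fop (tensor (letters n) (words n k)) i (a, x) = Some (a', x')" "c = a' # x'"
        using c unfolding w tens by auto
      then show ?thesis unfolding w using TD(4) by auto
    qed
  qed
qed

lemma epsilon_phi_words:
  assumes "i \<in> {1..2 * n - 1}" "length w = k"
  shows "epsilon (words n k) i w = weps i w" "phi (words n k) i w = wphi i w"
  using seminormal_on_depth[OF seminormal_on_words[OF assms(1), of k], of w] assms(2)
  by (auto simp: epsilon_def phi_def)

lemma epsilon_letters:
  assumes "i \<in> {1..2 * n - 1}"
  shows "epsilon (letters n) i a = of_bool (a = Suc i)"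
  using seminormal_on_depth[OF seminormal_on_letters[OF assms]] by (auto simp: epsilon_def)

lemma word_ops_Cons:
  assumes i: "i \<in> {1..2 * n - 1}" and k: "length w = k"
  shows "eop (words n (Suc k)) i (a # w) =
      (if of_bool (a = Suc i) > wphi i w then Some (i # w)
       else map_option (Cons a) (eop (words n k) i w))"
    "fop (words n (Suc k)) i (a # w) =
      (if of_bool (a = Suc i) \<ge> wphi i w then if a = i then Some (Suc i # w) else None
       else map_option (Cons a) (fop (words n k) i w))"
proof -
  have "eop (letters n) i a = (if a = Suc i then Some i else None)"
    "fop (letters n) i a = (if a = i then Some (Suc i) else None)"
    using i by (auto simp: letters_def)
  then show "eop (words n (Suc k)) i (a # w) =
      (if of_bool (a = Suc i) > wphi i w then Some (i # w)
       else map_option (Cons a) (eop (words n k) i w))"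
    "fop (words n (Suc k)) i (a # w) =
      (if of_bool (a = Suc i) \<ge> wphi i w then if a = i then Some (Suc i # w) else None
       else map_option (Cons a) (fop (words n k) i w))"
    by (auto simp: Let_def tensor_def epsilon_letters[OF i] epsilon_phi_words[OF i k]
        option.map_comp o_def)
qed

lemma weps_wphi_append:
  "weps i (u @ v) = weps i v + (weps i u - wphi i v)"
  "wphi i (u @ v) = wphi i u + (wphi i v - weps i u)"
  by (induction u) auto

text \<open>Associativity of the tensor product: the letters of \<open>u\<close> and \<open>v\<close>, bracketed to the right in
  \<open>u @ v\<close>, may be collected into two factors.\<close>

lemma word_ops_append:
  assumes i: "i \<in> {1..2 * n - 1}" and v: "length v = l"
  shows "length u = k \<Longrightarrow> eop (words n (k + l)) i (u @ v) =
      (if weps i u > wphi i v then map_option (\<lambda>x. x @ v) (eop (words n k) i u)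
       else map_option (\<lambda>x. u @ x) (eop (words n l) i v))"
    "length u = k \<Longrightarrow> fop (words n (k + l)) i (u @ v) =
      (if weps i u \<ge> wphi i v then map_option (\<lambda>x. x @ v) (fop (words n k) i u)
       else map_option (\<lambda>x. u @ x) (fop (words n l) i v))"
proof -
  have append_Nil_id: "(@) [] = (\<lambda>x :: nat list. x)" by auto
  \<comment> \<open>If \<open>u\<close> is empty and \<open>\<phi>\<^sub>i(v) = 0\<close>, the tensor rule lets \<open>f\<^sub>i\<close> act on the empty left factor, where it is undefined.\<close>
  have z: "fop (words n l) i v = None" if "wphi i v = 0"
    using seminormal_onD(2)[OF seminormal_on_words[OF i], of v l] v that by simp
  show "length u = k \<Longrightarrow> eop (words n (k + l)) i (u @ v) =
      (if weps i u > wphi i v then map_option (\<lambda>x. x @ v) (eop (words n k) i u)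
       else map_option (\<lambda>x. u @ x) (eop (words n l) i v))"
  proof (induction u arbitrary: k)
    case Nil
    then show ?case using append_Nil_id by (simp add: option.map_ident)
  next
    case (Cons a u)
    then obtain k' where k: "k = Suc k'" "length u = k'" by auto
    show ?case
      using word_ops_Cons(1)[OF i, of "u @ v" "k' + l" a] word_ops_Cons(1)[OF i k(2), of a]
        Cons.IH[OF k(2)] k v
      by (auto simp: weps_wphi_append option.map_comp o_def simp del: words.simps
          split: if_splits)
  qed
  show "length u = k \<Longrightarrow> fop (words n (k + l)) i (u @ v) =
      (if weps i u \<ge> wphi i v then map_option (\<lambda>x. x @ v) (fop (words n k) i u)
       else map_option (\<lambda>x. u @ x) (fop (words n l) i v))"
  proof (induction u arbitrary: k)
    case Nil
    then show ?case using z append_Nil_id by (simp add: option.map_ident)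
  next
    case (Cons a u)
    then obtain k' where k: "k = Suc k'" "length u = k'" by auto
    show ?case
      using word_ops_Cons(2)[OF i, of "u @ v" "k' + l" a] word_ops_Cons(2)[OF i k(2), of a]
        Cons.IH[OF k(2)] k v
      by (auto simp: weps_wphi_append option.map_comp o_def simp del: words.simps
          split: if_splits)
  qed
qed

section \<open>Columns\<close>

text \<open>On columns \<open>f\<^sub>j\<close> replaces the letter \<open>src n j\<close> by \<open>Suc j\<close>. For \<open>j = 0\<close> these are \<open>2n\<close> and \<open>1\<close>, so
  the affine operator obeys the same description as the classical ones.\<close>

definition src :: "nat \<Rightarrow> nat \<Rightarrow> nat" where
  "src n j = (if j = 0 then 2 * n else j)"

definition can_e :: "nat \<Rightarrow> nat \<Rightarrow> nat list \<Rightarrow> bool" where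
  "can_e n j w \<longleftrightarrow> Suc j \<in> set w \<and> src n j \<notin> set w"

definition can_f :: "nat \<Rightarrow> nat \<Rightarrow> nat list \<Rightarrow> bool" where
  "can_f n j w \<longleftrightarrow> src n j \<in> set w \<and> Suc j \<notin> set w"

definition replace :: "nat \<Rightarrow> nat \<Rightarrow> nat list \<Rightarrow> nat list" where
  "replace x y w = rev (sorted_list_of_set (insert y (set w - {x})))"

lemma set_replace [simp]: "set (replace x y w) = insert y (set w - {x})"
  by (simp add: replace_def del: sorted_list_of_set_insert_remove)

lemma sorted_replace [simp]: "sorted_wrt (>) (replace x y w)"
  unfolding replace_def sorted_wrt_rev by (rule strict_sorted_list_of_set)

lemma length_replace: "length (replace x y w) = card (insert y (set w - {x}))"
  unfolding replace_def length_rev by (rule length_sorted_list_of_set)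

lemma column_unique:
  assumes "sorted_wrt (>) w" "sorted_wrt (>) w'" "set w = set w'"
  shows "w = (w' :: nat list)"
proof -
  have "sorted (rev w)" "distinct (rev w)" "sorted (rev w')" "distinct (rev w')"
    using assms(1,2) strict_sorted_iff[of "rev w"] strict_sorted_iff[of "rev w'"]
    unfolding sorted_wrt_rev by simp_all
  then have "rev w = rev w'"
    using sorted_distinct_set_unique assms(3) by (metis set_rev)
  then show ?thesis by simp
qed

lemma columns_unique:
  assumes "w \<in> columns n k" "w' \<in> columns n k'" "set w = set w'"
  shows "w = w'"
  using assms column_unique by (auto simp: columns_def)

lemma columns_distinct:
  assumes "w \<in> columns n k"
  shows "distinct w"
proof -
  have "sorted_wrt (<) (rev w)" using assms by (simp add: columns_def sorted_wrt_rev)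
  then have "distinct (rev w)" using strict_sorted_iff by blast
  then show ?thesis by simp
qed

lemma replace_columns:
  assumes "w \<in> columns n k" "x \<in> set w" "y \<notin> set w" "y \<in> {1..2 * n}"
  shows "replace x y w \<in> columns n k"
proof -
  have "card (set w) = k"
    using assms(1) columns_distinct[OF assms(1)] by (auto simp: columns_def distinct_card)
  moreover have "card (insert y (set w - {x})) = card (set w)"
    using card_Suc_Diff1[of "set w" x] assms(2,3) by simp
  ultimately show ?thesis
    using assms by (auto simp: columns_def length_replace simp del: card_insert_disjoint)
qed

lemma replace_eqI:
  assumes "sorted_wrt (>) w'" "set w' = insert y (set w - {x})"
  shows "replace x y w = w'"
  using assms by (intro column_unique) auto

text \<open>In a decreasing word an \<open>i + 1\<close> stands immediately to the left of an \<open>i\<close>, so the two cancel if both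
  occur.\<close>

lemma weps_wphi_column:
  assumes "sorted_wrt (>) w"
  shows "weps i w = of_bool (Suc i \<in> set w \<and> i \<notin> set w)"
    "wphi i w = of_bool (i \<in> set w \<and> Suc i \<notin> set w)"
  using assms by (induction w) (auto split: if_splits)

lemma word_ops_column:
  assumes i: "i \<in> {1..2 * n - 1}" and "sorted_wrt (>) w"
  shows "eop (words n (length w)) i w = (if Suc i \<in> set w \<and> i \<notin> set w
      then Some (map (\<lambda>x. if x = Suc i then i else x) w) else None) \<and>
    fop (words n (length w)) i w = (if i \<in> set w \<and> Suc i \<notin> set w
      then Some (map (\<lambda>x. if x = i then Suc i else x) w) else None)"
  using assms(2)
proof (induction w)
  case (Cons a w)
  have w: "sorted_wrt (>) w" and a: "\<forall>x\<in>set w. x < a" using Cons.prems by auto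
  have id: "map (\<lambda>x. if x = y then z else x) w = w" if "y \<notin> set w" for y z
    using that by (auto intro!: map_idI)
  show ?case using Cons.IH[OF w] a id[of "Suc i" i] id[of i "Suc i"]
    by (auto simp: word_ops_Cons[OF i] weps_wphi_column[OF w] simp del: words.simps)
qed simp

text \<open>Exchanging a letter for an absent neighbour keeps its place in the order, since no entry of
  the column lies between the two.\<close>

lemma sorted_map_adjacent:
  assumes "sorted_wrt (>) w" "y \<notin> set w" "x = Suc y \<or> y = Suc x"
  shows "sorted_wrt (>) (map (\<lambda>a. if a = x then y else a) w)"
  using assms(1,2)
proof (induction w)
  case (Cons a w)
  have "(if b = x then y else b) < (if a = x then y else a)" if "b \<in> set w" for b
  proof -
    have "b < a" "b \<noteq> y" "a \<noteq> y" using Cons.prems that by auto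
    then show ?thesis using assms(3) by (auto split: if_splits)
  qed
  then have "\<forall>c\<in>set (map (\<lambda>a. if a = x then y else a) w). c < (if a = x then y else a)"
    by (simp only: set_map ball_simps) blast
  then show ?case using Cons by (simp only: list.map sorted_wrt.simps list.set insert_iff) simp
qed simp

lemma column_ops:
  assumes w: "w \<in> columns n k" and j: "j < 2 * n"
  shows "eop (column_crystal n k) j w =
      (if can_e n j w then Some (replace (Suc j) (src n j) w) else None)"
    "fop (column_crystal n k) j w =
      (if can_f n j w then Some (replace (src n j) (Suc j) w) else None)"
proof -
  have s: "sorted_wrt (>) w" and k: "length w = k" and r: "set w \<subseteq> {1..2 * n}"
    using w by (auto simp: columns_def)
  have sr: "sorted_wrt (>) (removeAll x w)" for x
    using s by (simp add: removeAll_filter_not_eq sorted_wrt_filter)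
  show "eop (column_crystal n k) j w =
      (if can_e n j w then Some (replace (Suc j) (src n j) w) else None)"
  proof (cases "j = 0")
    case True
    have "replace 1 (2 * n) w = 2 * n # removeAll 1 w" if "1 \<in> set w" "2 * n \<notin> set w"
    proof (rule replace_eqI)
      have "\<forall>x\<in>set w. x < 2 * n" using r that(2) by (metis atLeastAtMost_iff le_neq_implies_less subsetD)
      then show "sorted_wrt (>) (2 * n # removeAll 1 w)" using sr by simp
    qed simp
    then show ?thesis using True
      by (auto simp: column_crystal_def column_e0_def can_e_def src_def)
  next
    case False
    have "replace (Suc j) j w = map (\<lambda>x. if x = Suc j then j else x) w"
      if "Suc j \<in> set w" "j \<notin> set w"
      using sorted_map_adjacent[OF s that(2)] that by (intro replace_eqI) auto
    then show ?thesis using False j word_ops_column[OF _ s, of j n] k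
      by (auto simp: column_crystal_def can_e_def src_def)
  qed
  show "fop (column_crystal n k) j w =
      (if can_f n j w then Some (replace (src n j) (Suc j) w) else None)"
  proof (cases "j = 0")
    case True
    have "replace (2 * n) 1 w = removeAll (2 * n) w @ [1]" if "2 * n \<in> set w" "1 \<notin> set w"
    proof (rule replace_eqI)
      have "\<forall>x\<in>set w. 1 < x" using r that(2) by (metis atLeastAtMost_iff le_neq_implies_less subsetD)
      then show "sorted_wrt (>) (removeAll (2 * n) w @ [1])" using sr by (simp add: sorted_wrt_append)
    qed simp
    then show ?thesis using True
      by (auto simp: column_crystal_def column_f0_def can_f_def src_def)
  next
    case False
    have "replace j (Suc j) w = map (\<lambda>x. if x = j then Suc j else x) w"
      if "j \<in> set w" "Suc j \<notin> set w"
      using sorted_map_adjacent[OF s that(2)] that by (intro replace_eqI) auto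
    then show ?thesis using False j word_ops_column[OF _ s, of j n] k
      by (auto simp: column_crystal_def can_f_def src_def)
  qed
qed

lemma seminormal_on_columns:
  assumes j: "j < 2 * n"
  shows "seminormal_on (columns n k) (eop (column_crystal n k) j) (fop (column_crystal n k) j)
    (\<lambda>w. of_bool (can_e n j w)) (\<lambda>w. of_bool (can_f n j w))"
proof (rule seminormal_onI)
  have jn: "Suc j \<in> {1..2 * n}" "src n j \<in> {1..2 * n}" "src n j \<noteq> Suc j"
    using j by (auto simp: src_def)
  fix w assume w: "w \<in> columns n k"
  show "eop (column_crystal n k) j w = None \<longleftrightarrow> of_bool (can_e n j w) = (0 :: nat)"
    "fop (column_crystal n k) j w = None \<longleftrightarrow> of_bool (can_f n j w) = (0 :: nat)"
    by (simp_all add: column_ops[OF w j])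
  fix c
  show "c \<in> columns n k \<and> of_bool (can_e n j w) = Suc (of_bool (can_e n j c)) \<and>
      of_bool (can_f n j c) = Suc (of_bool (can_f n j w))"
    if "eop (column_crystal n k) j w = Some c"
    using that w jn replace_columns[OF w, of "Suc j" "src n j"]
    by (auto simp: column_ops[OF w j] can_e_def can_f_def split: if_splits)
  show "c \<in> columns n k \<and> of_bool (can_f n j w) = Suc (of_bool (can_f n j c)) \<and>
      of_bool (can_e n j c) = Suc (of_bool (can_e n j w))"
    if "fop (column_crystal n k) j w = Some c"
    using that w jn replace_columns[OF w, of "src n j" "Suc j"]
    by (auto simp: column_ops[OF w j] can_e_def can_f_def split: if_splits)
qed

section \<open>Pairs of columns\<close>

lemma ambient_stats:
  assumes "j < 2 * n" "u \<in> columns n (2 * n - r)" "v \<in> columns n r"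
  shows "epsilon (ambient n r) j (u, v) =
      of_bool (can_e n j v) + (of_bool (can_e n j u) - of_bool (can_f n j v))"
    "phi (ambient n r) j (u, v) =
      of_bool (can_f n j u) + (of_bool (can_f n j v) - of_bool (can_e n j u))"
  using seminormal_on_depth[OF seminormal_on_tensor[OF seminormal_on_columns[OF assms(1)]
        seminormal_on_columns[OF assms(1)]], of "(u, v)" "2 * n - r" r] assms(2,3)
  by (auto simp: epsilon_def phi_def ambient_def)

lemma ambient_ops:
  assumes "j < 2 * n" "u \<in> columns n (2 * n - r)" "v \<in> columns n r"
  shows "eop (ambient n r) j (u, v) =
      (if can_e n j u \<and> \<not> can_f n j v then Some (replace (Suc j) (src n j) u, v)
       else if can_e n j v then Some (u, replace (Suc j) (src n j) v) else None)"
    "fop (ambient n r) j (u, v) =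
      (if can_f n j v \<and> \<not> can_e n j u then Some (u, replace (src n j) (Suc j) v)
       else if can_f n j u then Some (replace (src n j) (Suc j) u, v) else None)"
proof -
  have e: "epsilon (column_crystal n (2 * n - r)) j u = of_bool (can_e n j u)"
    and f: "phi (column_crystal n r) j v = of_bool (can_f n j v)"
    using seminormal_on_depth[OF seminormal_on_columns[OF assms(1)]] assms(2,3)
    by (simp_all add: epsilon_def phi_def)
  show "eop (ambient n r) j (u, v) =
      (if can_e n j u \<and> \<not> can_f n j v then Some (replace (Suc j) (src n j) u, v)
       else if can_e n j v then Some (u, replace (Suc j) (src n j) v) else None)"
    using column_ops(1)[OF assms(2,1)] column_ops(1)[OF assms(3,1)]
    by (auto simp: ambient_def tensor_def e f)
  show "fop (ambient n r) j (u, v) =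
      (if can_f n j v \<and> \<not> can_e n j u then Some (u, replace (src n j) (Suc j) v)
       else if can_f n j u then Some (replace (src n j) (Suc j) u, v) else None)"
    using column_ops(2)[OF assms(2,1)] column_ops(2)[OF assms(3,1)]
    by (auto simp: ambient_def tensor_def e f can_e_def can_f_def)
qed

section \<open>Bracket sequences\<close>

text \<open>The sites describe \<open>u \<otimes> v\<close> through the pairs \<open>{k, 2n + 1 - k}\<close>, as explained at the top.
  Passing to the complement of \<open>u\<close> and reflecting the letters turns \<open>u\<close> into a column \<open>u\<^sup>*\<close> of
  height \<open>r\<close>; in terms of \<open>u\<^sup>*\<close> and \<open>v\<close> the sites \<open>Plus\<close> and \<open>Minus\<close> are those where both contain the
  same one of the two letters, and \<open>Open\<close> and \<open>Close\<close> those where they contain different ones.\<close>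

datatype site = Hole | Plus | Minus | Open | Close

definition site_at :: "nat \<Rightarrow> nat list \<Rightarrow> nat list \<Rightarrow> nat \<Rightarrow> site \<Rightarrow> bool" where
  "site_at n u v k s \<longleftrightarrow>
    (k \<in> set u \<longleftrightarrow> s \<in> {Hole, Plus, Open}) \<and>
    (2 * n + 1 - k \<in> set u \<longleftrightarrow> s \<in> {Hole, Minus, Close}) \<and>
    (k \<in> set v \<longleftrightarrow> s \<in> {Plus, Close}) \<and>
    (2 * n + 1 - k \<in> set v \<longleftrightarrow> s \<in> {Minus, Open})"

definition encodes :: "nat \<Rightarrow> nat \<Rightarrow> (nat \<Rightarrow> site) \<Rightarrow> nat list \<Rightarrow> nat list \<Rightarrow> bool" where
  "encodes n r p u v \<longleftrightarrow> u \<in> columns n (2 * n - r) \<and> v \<in> columns n r \<and>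
    (\<forall>k\<in>{1..n}. site_at n u v k (p k))"

text \<open>The effect of the virtual \<open>f\<^sub>i\<close> on the sites \<open>i\<close> and \<open>i + 1\<close>. For example, at \<open>Plus Minus\<close> both
  \<open>f\<^sub>i\<^sup>A\<close> and \<open>f\<^bsub>2n-i\<^esub>\<^sup>A\<close> have depth two; the virtual operator applies each of them once, both
  times to \<open>v\<close>, and a second application changes \<open>u\<close> in the same way.\<close>

fun f_pair :: "site \<Rightarrow> site \<Rightarrow> (site \<times> site) option" where
  "f_pair Plus Minus = Some (Open, Close)"
| "f_pair Open Close = Some (Minus, Plus)"
| "f_pair Plus t = (if t = Plus then None else Some (t, Plus))"
| "f_pair s Minus = (if s = Minus then None else Some (Minus, s))"
| "f_pair s t = None"

fun e_pair :: "site \<Rightarrow> site \<Rightarrow> (site \<times> site) option" where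
  "e_pair Minus Plus = Some (Open, Close)"
| "e_pair Open Close = Some (Plus, Minus)"
| "e_pair s Plus = (if s = Plus then None else Some (Plus, s))"
| "e_pair Minus t = (if t = Minus then None else Some (t, Minus))"
| "e_pair s t = None"

text \<open>Only the sites in \<open>K\<close> have to be inspected when the columns change at the letters in \<open>S\<close> and no
  other site owns one of these letters.\<close>

lemma encodes_update:
  assumes E: "encodes n r p u v"
    and col: "u' \<in> columns n (2 * n - r)" "v' \<in> columns n r"
    and S: "\<And>k. k \<in> {1..n} \<Longrightarrow> k \<notin> K \<Longrightarrow> p' k = p k \<and> k \<notin> S \<and> 2 * n + 1 - k \<notin> S"
    and same: "\<forall>x. x \<notin> S \<longrightarrow> (x \<in> set u' \<longleftrightarrow> x \<in> set u) \<and> (x \<in> set v' \<longleftrightarrow> x \<in> set v)"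
    and new: "\<And>k. k \<in> K \<Longrightarrow> site_at n u' v' k (p' k)"
  shows "encodes n r p' u' v'"
  unfolding encodes_def
proof (intro conjI ballI col)
  fix k assume k: "k \<in> {1..n}"
  show "site_at n u' v' k (p' k)"
  proof (cases "k \<in> K")
    case False
    have "site_at n u v k (p k)" using E k by (simp add: encodes_def)
    then show ?thesis using S[OF k False] same unfolding site_at_def by metis
  qed (rule new)
qed

text \<open>The type A indices \<open>i\<close> and \<open>2n - i\<close> move the letters \<open>i, i + 1\<close> and \<open>2n - i, 2n + 1 - i\<close>, which are
  exactly the letters owned by the sites \<open>i\<close> and \<open>i + 1\<close>; this leaves a check of the 23 remaining
  combinations. At the two excluded ones the depths for \<open>i\<close> and for \<open>2n - i\<close> differ: at
  \<open>Hole Close\<close> they are \<open>1\<close> and \<open>0\<close>, at \<open>Open Hole\<close> they are \<open>0\<close> and \<open>1\<close>.\<close>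

lemma virtual_pair_step:
  assumes E: "encodes n r p u v" and i: "1 \<le> i" "i < n"
    and adm: "(p i, p (Suc i)) \<noteq> (Hole, Close)" "(p i, p (Suc i)) \<noteq> (Open, Hole)"
  shows "case f_pair (p i) (p (Suc i)) of
      None \<Rightarrow> virtual_op n (fop (ambient n r)) i (u, v) = None
    | Some (c, d) \<Rightarrow> \<exists>u' v'. virtual_op n (fop (ambient n r)) i (u, v) = Some (u', v') \<and>
        encodes n r (p(i := c, Suc i := d)) u' v'" (is ?f)
    and "case e_pair (p i) (p (Suc i)) of
      None \<Rightarrow> virtual_op n (eop (ambient n r)) i (u, v) = None
    | Some (c, d) \<Rightarrow> \<exists>u' v'. virtual_op n (eop (ambient n r)) i (u, v) = Some (u', v') \<and>
        encodes n r (p(i := c, Suc i := d)) u' v'" (is ?e)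
    and "phi (ambient n r) i (u, v) = phi (ambient n r) (2 * n - i) (u, v)" (is ?phi)
    and "epsilon (ambient n r) i (u, v) = epsilon (ambient n r) (2 * n - i) (u, v)" (is ?epsilon)
proof -
  \<comment> \<open>The index \<open>j\<close> is kept opaque so that the letters \<open>i\<close>, \<open>i + 1\<close>, \<open>j\<close>, \<open>j + 1\<close> are compared by the facts \<open>d\<close> alone.\<close>
  obtain j where j: "j = 2 * n - i" by simp
  have d: "i < 2 * n" "j < 2 * n" "n < j" "Suc i \<noteq> j" "i \<noteq> j" "j \<noteq> i" "i \<noteq> Suc j" "j \<noteq> Suc i"
    "Suc j \<noteq> i" "src n i = i" "src n j = j" "Suc j \<le> 2 * n" "Suc i \<le> 2 * n" "i \<noteq> 0" "j \<noteq> 0" "i \<noteq> n"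
    "Suc 0 \<le> i" "i \<le> 2 * n" "Suc 0 \<le> j" "j \<le> 2 * n"
    "2 * n - i = j" "Suc (2 * n) - i = Suc j"
    using i j by (auto simp: src_def)
  have u: "u \<in> columns n (2 * n - r)" and v: "v \<in> columns n r"
    using E by (auto simp: encodes_def)
  have "site_at n u v i (p i)" "site_at n u v (Suc i) (p (Suc i))"
    using E i by (auto simp: encodes_def)
  then have mem: "i \<in> set u \<longleftrightarrow> p i \<in> {Hole, Plus, Open}" "Suc j \<in> set u \<longleftrightarrow> p i \<in> {Hole, Minus, Close}"
    "i \<in> set v \<longleftrightarrow> p i \<in> {Plus, Close}" "Suc j \<in> set v \<longleftrightarrow> p i \<in> {Minus, Open}"
    "Suc i \<in> set u \<longleftrightarrow> p (Suc i) \<in> {Hole, Plus, Open}"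
    "j \<in> set u \<longleftrightarrow> p (Suc i) \<in> {Hole, Minus, Close}"
    "Suc i \<in> set v \<longleftrightarrow> p (Suc i) \<in> {Plus, Close}" "j \<in> set v \<longleftrightarrow> p (Suc i) \<in> {Minus, Open}"
    by (simp_all add: site_at_def d)
  have enc: "encodes n r (p(i := c, Suc i := d)) u' v'"
    if "u' \<in> columns n (2 * n - r)" "v' \<in> columns n r"
      and same: "\<forall>x. x \<notin> {i, Suc i, j, Suc j} \<longrightarrow> (x \<in> set u' \<longleftrightarrow> x \<in> set u) \<and> (x \<in> set v' \<longleftrightarrow> x \<in> set v)"
      and "site_at n u' v' i c" "site_at n u' v' (Suc i) d" for u' v' c d
  proof (rule encodes_update[OF E that(1,2) _ same, where K = "{i, Suc i}"])
    show "(p(i := c, Suc i := d)) k = p k \<and> k \<notin> {i, Suc i, j, Suc j} \<and> 2 * n + 1 - k \<notin> {i, Suc i, j, Suc j}"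
      if "k \<in> {1..n}" "k \<notin> {i, Suc i}" for k
      using that i unfolding j by (simp; linarith)
    show "site_at n u' v' k ((p(i := c, Suc i := d)) k)" if "k \<in> {i, Suc i}" for k
      using that \<open>site_at n u' v' i c\<close> \<open>site_at n u' v' (Suc i) d\<close> by auto
  qed
  have vop: "virtual_op n g i b = Option.bind (g i b) (g j)" for g and b :: "nat list \<times> nat list"
    using i by (simp add: virtual_op_def j)
  note sel = vop ambient_ops can_f_def can_e_def replace_columns u v mem d
  show ?f
    apply (cases "p i"; cases "p (Suc i)")
    apply (use adm in \<open>simp_all add: sel\<close>)
    apply (rule enc; simp add: sel site_at_def)+
    done
  show ?e
    apply (cases "p i"; cases "p (Suc i)")
    apply (use adm in \<open>simp_all add: sel\<close>)
    apply (rule enc; simp add: sel site_at_def)+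
    done
  have st: "epsilon (ambient n r) k (u, v) =
      of_bool (can_e n k v) + (of_bool (can_e n k u) - of_bool (can_f n k v))"
    "phi (ambient n r) k (u, v) =
      of_bool (can_f n k u) + (of_bool (can_f n k v) - of_bool (can_e n k u))"
    if "k \<in> {i, j}" for k
    using ambient_stats[OF _ u v, of k] d(1,2) that by auto
  show ?phi ?epsilon
    using adm unfolding j[symmetric]
    by (cases "p i"; cases "p (Suc i)"; simp add: st can_f_def can_e_def mem d)+
qed

definition f_last :: "site \<Rightarrow> site option" where
  "f_last s = (case s of Plus \<Rightarrow> Some Open | Open \<Rightarrow> Some Minus | _ \<Rightarrow> None)"

definition e_last :: "site \<Rightarrow> site option" where
  "e_last s = (case s of Minus \<Rightarrow> Some Open | Open \<Rightarrow> Some Plus | _ \<Rightarrow> None)"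

text \<open>The letters \<open>n\<close> and \<open>n + 1\<close> of the index \<open>n\<close> are both owned by the last site. At \<open>Close\<close> the entry
  \<open>n + 1\<close> of \<open>u\<close> cancels with the entry \<open>n\<close> of \<open>v\<close>, and both operators are undefined.\<close>

lemma virtual_last_step:
  assumes E: "encodes n r p u v" and n: "1 \<le> n"
  shows "case f_last (p n) of
      None \<Rightarrow> virtual_op n (fop (ambient n r)) n (u, v) = None
    | Some c \<Rightarrow> \<exists>u' v'. virtual_op n (fop (ambient n r)) n (u, v) = Some (u', v') \<and>
        encodes n r (p(n := c)) u' v'" (is ?f)
    and "case e_last (p n) of
      None \<Rightarrow> virtual_op n (eop (ambient n r)) n (u, v) = None
    | Some c \<Rightarrow> \<exists>u' v'. virtual_op n (eop (ambient n r)) n (u, v) = Some (u', v') \<and>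
        encodes n r (p(n := c)) u' v'" (is ?e)
proof -
  have d: "n < 2 * n" "src n n = n" "Suc n \<le> 2 * n" "n \<noteq> 0" "Suc 0 \<le> n" "Suc (2 * n) - n = Suc n"
    using n by (auto simp: src_def)
  have u: "u \<in> columns n (2 * n - r)" and v: "v \<in> columns n r"
    using E by (auto simp: encodes_def)
  have "site_at n u v n (p n)" using E n by (auto simp: encodes_def)
  then have mem: "n \<in> set u \<longleftrightarrow> p n \<in> {Hole, Plus, Open}" "Suc n \<in> set u \<longleftrightarrow> p n \<in> {Hole, Minus, Close}"
    "n \<in> set v \<longleftrightarrow> p n \<in> {Plus, Close}" "Suc n \<in> set v \<longleftrightarrow> p n \<in> {Minus, Open}"
    by (simp_all add: site_at_def d)
  have enc: "encodes n r (p(n := c)) u' v'"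
    if "u' \<in> columns n (2 * n - r)" "v' \<in> columns n r"
      and same: "\<forall>x. x \<notin> {n, Suc n} \<longrightarrow> (x \<in> set u' \<longleftrightarrow> x \<in> set u) \<and> (x \<in> set v' \<longleftrightarrow> x \<in> set v)"
      and "site_at n u' v' n c" for u' v' c
  proof (rule encodes_update[OF E that(1,2) _ same, where K = "{n}"])
    show "(p(n := c)) k = p k \<and> k \<notin> {n, Suc n} \<and> 2 * n + 1 - k \<notin> {n, Suc n}"
      if "k \<in> {1..n}" "k \<notin> {n}" for k
      using that by (simp; linarith)
    show "site_at n u' v' k ((p(n := c)) k)" if "k \<in> {n}" for k
      using that \<open>site_at n u' v' n c\<close> by simp
  qed
  have vop: "virtual_op n g n b = g n b" for g and b :: "nat list \<times> nat list"
    using n by (simp add: virtual_op_def)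
  note sel = vop ambient_ops can_f_def can_e_def replace_columns u v mem d n f_last_def e_last_def
  show ?f
    apply (cases "p n")
    apply (simp_all add: sel)
    apply (rule enc; simp add: sel site_at_def)+
    done
  show ?e
    apply (cases "p n")
    apply (simp_all add: sel)
    apply (rule enc; simp add: sel site_at_def)+
    done
qed

text \<open>The letters \<open>1\<close> and \<open>2n\<close> of the index \<open>0\<close> are owned by the first site. At \<open>Plus\<close> and \<open>Minus\<close> both
  columns are in the same state, so the depths are \<open>0\<close> and \<open>2\<close> and the square of the type A operator
  exchanges these sites. At \<open>Open\<close> the two columns cancel; at \<open>Close\<close> they would give depths \<open>1\<close>.\<close>

lemma virtual_zero_step:
  assumes E: "encodes n r p u v" and n: "1 \<le> n" and adm: "p 1 \<noteq> Close"
  shows "if p 1 = Minus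
      then \<exists>u' v'. virtual_op n (fop (ambient n r)) 0 (u, v) = Some (u', v') \<and>
        encodes n r (p(1 := Plus)) u' v'
      else virtual_op n (fop (ambient n r)) 0 (u, v) = None" (is ?f)
    and "if p 1 = Plus
      then \<exists>u' v'. virtual_op n (eop (ambient n r)) 0 (u, v) = Some (u', v') \<and>
        encodes n r (p(1 := Minus)) u' v'
      else virtual_op n (eop (ambient n r)) 0 (u, v) = None" (is ?e)
    and "even (phi (ambient n r) 0 (u, v))" (is ?phi)
    and "even (epsilon (ambient n r) 0 (u, v))" (is ?epsilon)
proof -
  have d: "0 < 2 * n" "src n 0 = 2 * n" "2 * n \<noteq> Suc 0" "Suc 0 \<noteq> 2 * n" "Suc 0 \<le> 2 * n" "0 < n" "Suc 0 \<le> n"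
    using n by (auto simp: src_def)
  have u: "u \<in> columns n (2 * n - r)" and v: "v \<in> columns n r"
    using E by (auto simp: encodes_def)
  have "site_at n u v 1 (p 1)" using E n by (auto simp: encodes_def)
  then have mem: "Suc 0 \<in> set u \<longleftrightarrow> p 1 \<in> {Hole, Plus, Open}" "2 * n \<in> set u \<longleftrightarrow> p 1 \<in> {Hole, Minus, Close}"
    "Suc 0 \<in> set v \<longleftrightarrow> p 1 \<in> {Plus, Close}" "2 * n \<in> set v \<longleftrightarrow> p 1 \<in> {Minus, Open}"
    by (simp_all add: site_at_def d)
  have enc: "encodes n r (p(1 := c)) u' v'"
    if "u' \<in> columns n (2 * n - r)" "v' \<in> columns n r"
      and same: "\<forall>x. x \<notin> {1, 2 * n} \<longrightarrow> (x \<in> set u' \<longleftrightarrow> x \<in> set u) \<and> (x \<in> set v' \<longleftrightarrow> x \<in> set v)"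
      and "site_at n u' v' 1 c" for u' v' c
  proof (rule encodes_update[OF E that(1,2) _ same, where K = "{1}"])
    show "(p(1 := c)) k = p k \<and> k \<notin> {1, 2 * n} \<and> 2 * n + 1 - k \<notin> {1, 2 * n}"
      if "k \<in> {1..n}" "k \<notin> {1}" for k
      using that n by (simp; linarith)
    show "site_at n u' v' k ((p(1 := c)) k)" if "k \<in> {1}" for k
      using that \<open>site_at n u' v' 1 c\<close> by simp
  qed
  have vop: "virtual_op n g 0 b = Option.bind (g 0 b) (g 0)" for g and b :: "nat list \<times> nat list"
    by (simp add: virtual_op_def numeral_2_eq_2)
  note sel = vop ambient_ops can_f_def can_e_def replace_columns u v mem d
  note st = ambient_stats[OF d(1) u v]
  show ?f
    using adm apply (cases "p 1")
    apply (simp_all add: sel)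
    apply (rule enc[unfolded One_nat_def]; simp add: sel site_at_def)+
    done
  show ?e
    using adm apply (cases "p 1")
    apply (simp_all add: sel)
    apply (rule enc[unfolded One_nat_def]; simp add: sel site_at_def)+
    done
  show ?phi ?epsilon
    using adm by (cases "p 1"; simp add: st can_f_def can_e_def mem d)+
qed

definition bracket :: "site \<Rightarrow> int" where
  "bracket s = (case s of Open \<Rightarrow> 1 | Close \<Rightarrow> - 1 | _ \<Rightarrow> 0)"

primrec height :: "(nat \<Rightarrow> site) \<Rightarrow> nat \<Rightarrow> int" where
  "height p 0 = 0"
| "height p (Suc k) = height p k + bracket (p (Suc k))"

text \<open>The condition at a \<open>Hole\<close> says that the brackets to its left are balanced.\<close>

definition legal :: "nat \<Rightarrow> (nat \<Rightarrow> site) \<Rightarrow> bool" where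
  "legal n p \<longleftrightarrow> (\<forall>k<n. 0 \<le> height p (Suc k) \<and> (p (Suc k) = Hole \<longrightarrow> height p k = 0))"

lemma legal_nonneg: "legal n p \<Longrightarrow> k \<le> n \<Longrightarrow> 0 \<le> height p k"
  by (cases k) (auto simp: legal_def simp del: height.simps(2))

text \<open>A \<open>Close\<close> after a \<open>Hole\<close> would have no partner, and a \<open>Hole\<close> after an \<open>Open\<close> would lie inside an
  open bracket.\<close>

lemma legal_adjacent:
  assumes "legal n p" "1 \<le> i" "i < n"
  shows "(p i, p (Suc i)) \<noteq> (Hole, Close)" "(p i, p (Suc i)) \<noteq> (Open, Hole)"
proof -
  obtain m where m: "i = Suc m" using assms(2) by (cases i) auto
  have "0 \<le> height p m" "0 \<le> height p (Suc i)" "p i = Hole \<longrightarrow> height p m = 0"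
    "p (Suc i) = Hole \<longrightarrow> height p i = 0"
    using assms m legal_nonneg[OF assms(1)] by (auto simp: legal_def simp del: height.simps(2))
  then show "(p i, p (Suc i)) \<noteq> (Hole, Close)" "(p i, p (Suc i)) \<noteq> (Open, Hole)"
    by (auto simp: m bracket_def)
qed

lemma legal_not_Close_first:
  assumes "legal n p" "1 \<le> n"
  shows "p 1 \<noteq> Close"
  using legal_nonneg[OF assms] by (auto simp: bracket_def)

lemma height_cong: "(\<And>l. 1 \<le> l \<Longrightarrow> l \<le> k \<Longrightarrow> p l = q l) \<Longrightarrow> height p k = height q k"
  by (induction k) auto

text \<open>What the 25 cases of a move \<open>a b \<mapsto> c d\<close> have in common, as far as legality is concerned: the total
  height is kept, a \<open>Hole\<close> only changes place with a neighbour of height zero, and a \<open>Close\<close> moves to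
  the left only past such a neighbour.\<close>

lemma pair_moves:
  assumes "f_pair a b = Some (c, d) \<or> e_pair a b = Some (c, d)"
  shows "bracket c + bracket d = bracket a + bracket b"
    "c = Hole \<Longrightarrow> b = Hole" "d = Hole \<Longrightarrow> a = Hole \<and> bracket c = 0" "bracket c < 0 \<Longrightarrow> bracket b < 0 \<and> bracket a = 0"
    "c = Hole \<Longrightarrow> bracket a = 0"
  using assms by (cases a; cases b; auto simp: bracket_def)+

text \<open>The heights before the site \<open>i\<close> and from the site \<open>i + 1\<close> on do not change, so only the height
  between the two sites needs an argument.\<close>

lemma legal_pair_move:
  assumes L: "legal n p" and i: "1 \<le> i" "i < n"
    and mv: "f_pair (p i) (p (Suc i)) = Some (c, d) \<or> e_pair (p i) (p (Suc i)) = Some (c, d)"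
  shows "legal n (p(i := c, Suc i := d))"
proof -
  obtain m where m: "i = Suc m" using i by (cases i) auto
  let ?q = "p(i := c, Suc i := d)"
  note M = pair_moves[OF mv]
  have low: "height ?q k = height p k" if "k \<le> m" for k
    using that m by (intro height_cong) auto
  have mid: "height ?q (Suc m) = height p m + bracket c"
    using low[of m] m by simp
  have high: "height ?q k = height p k" if "Suc (Suc m) \<le> k" for k
    using that
  proof (induction k rule: dec_induct)
    case base
    have "height ?q (Suc (Suc m)) = height p m + bracket c + bracket d"
      by (simp only: height.simps(2)[of ?q "Suc m"] mid) (simp add: m)
    also have "\<dots> = height p (Suc (Suc m))" using m M(1) by simp
    finally show ?case .
  next
    case (step k)
    then show ?case using m by simp
  qed
  have nn: "0 \<le> height p m" "0 \<le> height p (Suc m)" "0 \<le> height p (Suc (Suc m))"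
    using legal_nonneg[OF L] i m by (auto simp del: height.simps(2))
  have hole: "p i = Hole \<longrightarrow> height p m = 0" "p (Suc i) = Hole \<longrightarrow> height p (Suc m) = 0"
    using L i m by (auto simp: legal_def simp del: height.simps(2))
  have "0 \<le> height ?q (Suc k) \<and> (?q (Suc k) = Hole \<longrightarrow> height ?q k = 0)" if k: "k < n" for k
  proof -
    consider "k < m" | "k = m" | "k = Suc m" | "Suc m < k" by linarith
    then show ?thesis
    proof cases
      case 1
      then show ?thesis using L k low[of k] low[of "Suc k"] m
        by (auto simp: legal_def simp del: height.simps(2))
    next
      case 2
      \<comment> \<open>If the height drops at the site \<open>i\<close>, it dropped by the same amount at the site \<open>i + 1\<close> before.\<close>
      have "0 \<le> height p m + bracket c"
      proof (cases "bracket c < 0")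
        case True
        then have "bracket (p (Suc i)) < 0" "bracket (p i) = 0" using M(4) by auto
        moreover have "bracket c = - 1" using True by (auto simp: bracket_def split: site.splits)
        ultimately show ?thesis using nn(3) m
          by (auto simp: bracket_def split: site.splits)
      qed (use nn(1) in linarith)
      moreover have "c = Hole \<longrightarrow> height p m = 0"
        using M(2,5) hole(2) m by auto
      ultimately show ?thesis using 2 mid low[of m] m by (auto simp del: height.simps(2))
    next
      case 3
      then show ?thesis using nn(3) high[of "Suc (Suc m)"] mid M(3) hole(1) m
        by (auto simp del: height.simps(2))
    next
      case 4
      then show ?thesis using L k high[of k] high[of "Suc k"] m
        by (auto simp: legal_def simp del: height.simps(2))
    qed
  qed
  then show ?thesis by (simp add: legal_def)
qed

text \<open>An \<open>Open\<close> at the last site may remain unmatched.\<close>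

lemma legal_replace_last:
  assumes L: "legal n p" and n: "1 \<le> n" and c: "c \<noteq> Hole" "0 \<le> bracket c"
  shows "legal n (p(n := c))"
proof -
  obtain m where m: "n = Suc m" using n by (cases n) auto
  have low: "height (p(n := c)) k = height p k" if "k < n" for k
    using that by (intro height_cong) auto
  have "0 \<le> height (p(n := c)) (Suc m)"
    using low[of m] legal_nonneg[OF L, of m] m c by simp
  moreover have "height (p(n := c)) (Suc k) = height p (Suc k)" if "k < m" for k
    using low[of "Suc k"] that m by simp
  ultimately show ?thesis
    using L low m c(1) by (auto simp: legal_def less_Suc_eq simp del: height.simps(2))
qed

lemma legal_replace_sign:
  assumes L: "legal n p" and c: "c \<noteq> Hole" "bracket c = bracket (p k)"
  shows "legal n (p(k := c))"
proof -
  have "height (p(k := c)) l = height p l" for l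
    using c(2) by (induction l) auto
  then show ?thesis using L c(1) by (auto simp: legal_def simp del: height.simps(2))
qed

section \<open>The legal_pairs\<close>

definition legal_pairs :: "nat \<Rightarrow> nat \<Rightarrow> (nat list \<times> nat list) set" where
  "legal_pairs n r = {(u, v). \<exists>p. legal n p \<and> encodes n r p u v}"

lemma legal_pairs_closed:
  assumes n: "1 \<le> n" and b: "b \<in> legal_pairs n r" and i: "i \<le> n"
  shows "virtual_op n (fop (ambient n r)) i b = Some c \<Longrightarrow> c \<in> legal_pairs n r"
    "virtual_op n (eop (ambient n r)) i b = Some c \<Longrightarrow> c \<in> legal_pairs n r"
proof -
  obtain u v p where b: "b = (u, v)" and L: "legal n p" and E: "encodes n r p u v"
    using b by (auto simp: legal_pairs_def)
  consider "i = 0" | "1 \<le> i" "i < n" | "i = n" using i by linarith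
  note cs = this
  show "c \<in> legal_pairs n r" if c: "virtual_op n (fop (ambient n r)) i b = Some c"
    using cs
  proof cases
    case 1
    note st = virtual_zero_step(1)[OF E n legal_not_Close_first[OF L n]]
    show ?thesis
    proof (cases "p 1 = Minus")
      case True
      then obtain u' v' where "c = (u', v')" "encodes n r (p(1 := Plus)) u' v'"
        using st c b 1 by auto
      moreover have "legal n (p(1 := Plus))"
        using True by (intro legal_replace_sign[OF L]) (auto simp: bracket_def)
      ultimately show ?thesis by (auto simp: legal_pairs_def)
    qed (use st c b 1 in auto)
  next
    case 2
    note st = virtual_pair_step(1)[OF E 2 legal_adjacent[OF L 2]]
    show ?thesis
    proof (cases "f_pair (p i) (p (Suc i))")
      case (Some cd)
      then obtain x y where xy: "f_pair (p i) (p (Suc i)) = Some (x, y)" by (cases cd) auto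
      then obtain u' v' where "c = (u', v')" "encodes n r (p(i := x, Suc i := y)) u' v'"
        using st c b by auto
      then show ?thesis using legal_pair_move[OF L 2] xy by (auto simp: legal_pairs_def)
    qed (use st c b in auto)
  next
    case 3
    note st = virtual_last_step(1)[OF E n]
    show ?thesis
    proof (cases "f_last (p n)")
      case (Some x)
      then obtain u' v' where "c = (u', v')" "encodes n r (p(n := x)) u' v'"
        using st c b 3 by auto
      moreover have "x \<noteq> Hole" "0 \<le> bracket x"
        using Some by (auto simp: f_last_def bracket_def split: site.splits)
      ultimately show ?thesis using legal_replace_last[OF L n] by (auto simp: legal_pairs_def)
    qed (use st c b 3 in auto)
  qed
  show "c \<in> legal_pairs n r" if c: "virtual_op n (eop (ambient n r)) i b = Some c"
    using cs
  proof cases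
    case 1
    note st = virtual_zero_step(2)[OF E n legal_not_Close_first[OF L n]]
    show ?thesis
    proof (cases "p 1 = Plus")
      case True
      then obtain u' v' where "c = (u', v')" "encodes n r (p(1 := Minus)) u' v'"
        using st c b 1 by auto
      moreover have "legal n (p(1 := Minus))"
        using True by (intro legal_replace_sign[OF L]) (auto simp: bracket_def)
      ultimately show ?thesis by (auto simp: legal_pairs_def)
    qed (use st c b 1 in auto)
  next
    case 2
    note st = virtual_pair_step(2)[OF E 2 legal_adjacent[OF L 2]]
    show ?thesis
    proof (cases "e_pair (p i) (p (Suc i))")
      case (Some cd)
      then obtain x y where xy: "e_pair (p i) (p (Suc i)) = Some (x, y)" by (cases cd) auto
      then obtain u' v' where "c = (u', v')" "encodes n r (p(i := x, Suc i := y)) u' v'"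
        using st c b by auto
      then show ?thesis using legal_pair_move[OF L 2] xy by (auto simp: legal_pairs_def)
    qed (use st c b in auto)
  next
    case 3
    note st = virtual_last_step(2)[OF E n]
    show ?thesis
    proof (cases "e_last (p n)")
      case (Some x)
      then obtain u' v' where "c = (u', v')" "encodes n r (p(n := x)) u' v'"
        using st c b 3 by auto
      moreover have "x \<noteq> Hole" "0 \<le> bracket x"
        using Some by (auto simp: e_last_def bracket_def split: site.splits)
      ultimately show ?thesis using legal_replace_last[OF L n] by (auto simp: legal_pairs_def)
    qed (use st c b 3 in auto)
  qed
qed

lemma legal_pairs_aligned:
  assumes n: "1 \<le> n"
  shows "aligned n (ambient n r) (legal_pairs n r)"
  unfolding aligned_def
proof (intro ballI conjI)
  fix b assume "b \<in> legal_pairs n r"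
  then obtain u v p where b: "b = (u, v)" and L: "legal n p" and E: "encodes n r p u v"
    by (auto simp: legal_pairs_def)
  show "even (phi (ambient n r) 0 b)" "even (epsilon (ambient n r) 0 b)"
    using virtual_zero_step(3,4)[OF E n legal_not_Close_first[OF L n]] b by auto
  fix i assume "i \<in> {1..n - 1}"
  then have i: "1 \<le> i" "i < n" by auto
  show "phi (ambient n r) i b = phi (ambient n r) (2 * n - i) b"
    "epsilon (ambient n r) i b = epsilon (ambient n r) (2 * n - i) b"
    unfolding b by (rule virtual_pair_step(3,4)[OF E i legal_adjacent[OF L i]])+
qed

section \<open>Connectedness\<close>

text \<open>The sites determine the columns including their heights, so \<open>r\<close> and \<open>r'\<close> may differ a priori. A pair
  with sites \<open>Plus\<close> up to \<open>m\<close> and \<open>Hole\<close> from there on is thus recognized as the generator, and \<open>m = r\<close>.\<close>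

lemma encodes_unique:
  assumes "encodes n r p u v" "encodes n r' q u' v'" "\<forall>k\<in>{1..n}. p k = q k"
  shows "u = u'" "v = v'"
proof -
  have "(x \<in> set u \<longleftrightarrow> x \<in> set u') \<and> (x \<in> set v \<longleftrightarrow> x \<in> set v')" if x: "x \<in> {1..2 * n}" for x
  proof (cases "x \<le> n")
    case True
    then have "site_at n u v x (p x)" "site_at n u' v' x (p x)"
      using assms x by (auto simp: encodes_def)
    then show ?thesis by (simp add: site_at_def)
  next
    case False
    define k where "k = 2 * n + 1 - x"
    have k: "k \<in> {1..n}" "x = 2 * n + 1 - k" using False x by (auto simp: k_def)
    then have "site_at n u v k (p k)" "site_at n u' v' k (p k)"
      using assms by (auto simp: encodes_def)
    then show ?thesis unfolding site_at_def k(2)[symmetric] by simp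
  qed
  moreover have "set u \<subseteq> {1..2 * n}" "set v \<subseteq> {1..2 * n}" "set u' \<subseteq> {1..2 * n}" "set v' \<subseteq> {1..2 * n}"
    using assms by (auto simp: encodes_def columns_def)
  ultimately have "set u = set u'" "set v = set v'" by blast+
  then show "u = u'" "v = v'" using assms columns_unique by (metis encodes_def)+
qed

lemma encodes_top:
  assumes "m \<le> n" "\<forall>k\<in>{1..n}. p k = (if k \<le> m then Plus else Hole)"
  shows "encodes n m p (top_column (2 * n - m)) (top_column m)"
proof -
  have "set (top_column h) = {1..h}" for h by (auto simp: top_column_def)
  then show ?thesis
    using assms by (auto simp: encodes_def top_column_in_columns site_at_def)
qed

lemma f_pair_e_pair: "e_pair a b = Some (c, d) \<Longrightarrow> f_pair c d = Some (a, b)"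
  by (cases a; cases b; auto)

lemma f_last_e_last: "e_last a = Some c \<Longrightarrow> f_last c = Some a"
  by (cases a) (auto simp: e_last_def f_last_def)

text \<open>On sites the moves of \<open>f\<^sub>i\<close> and \<open>e\<^sub>i\<close> are inverse to each other, and the sites determine the
  columns.\<close>

lemma virtual_f_after_e:
  assumes n: "1 \<le> n" and b: "b \<in> legal_pairs n r" and i: "1 \<le> i" "i \<le> n"
    and c: "virtual_op n (eop (ambient n r)) i b = Some c"
  shows "virtual_op n (fop (ambient n r)) i c = Some b"
proof -
  obtain u v p where b: "b = (u, v)" and L: "legal n p" and E: "encodes n r p u v"
    using b by (auto simp: legal_pairs_def)
  show ?thesis
  proof (cases "i < n")
    case True
    note i' = i(1) True
    note st = virtual_pair_step(2)[OF E i' legal_adjacent[OF L i']]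
    obtain x y where xy: "e_pair (p i) (p (Suc i)) = Some (x, y)"
      using st c b by (cases "e_pair (p i) (p (Suc i))") auto
    let ?q = "p(i := x, Suc i := y)"
    obtain u' v' where c': "c = (u', v')" and E': "encodes n r ?q u' v'"
      using st c b xy by auto
    have L': "legal n ?q" using legal_pair_move[OF L i'] xy by blast
    have "f_pair (?q i) (?q (Suc i)) = Some (p i, p (Suc i))" using f_pair_e_pair[OF xy] by simp
    with virtual_pair_step(1)[OF E' i' legal_adjacent[OF L' i']]
    obtain u'' v'' where "virtual_op n (fop (ambient n r)) i c = Some (u'', v'')"
      and "encodes n r (?q(i := p i, Suc i := p (Suc i))) u'' v''" using c' by auto
    moreover have "?q(i := p i, Suc i := p (Suc i)) = p" by auto
    ultimately show ?thesis using encodes_unique[OF E] b by metis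
  next
    case False
    then have i: "i = n" using i by simp
    note st = virtual_last_step(2)[OF E n]
    obtain x where x: "e_last (p n) = Some x"
      using st c b i by (cases "e_last (p n)") auto
    obtain u' v' where c': "c = (u', v')" and E': "encodes n r (p(n := x)) u' v'"
      using st c b x i by auto
    have "f_last ((p(n := x)) n) = Some (p n)" using f_last_e_last[OF x] by simp
    with virtual_last_step(1)[OF E' n]
    obtain u'' v'' where "virtual_op n (fop (ambient n r)) n c = Some (u'', v'')"
      and "encodes n r ((p(n := x))(n := p n)) u'' v''" using c' by auto
    moreover have "(p(n := x))(n := p n) = p" by auto
    ultimately show ?thesis using encodes_unique[OF E] b i by metis
  qed
qed

text \<open>A measure for induction along the raising operators with nonzero index, each of which replaces
  letters by smaller ones.\<close>

definition letter_sum :: "nat list \<times> nat list \<Rightarrow> nat" where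
  "letter_sum b = \<Sum> (set (fst b)) + \<Sum> (set (snd b))"

lemma ambient_e_letter_sum:
  assumes j: "1 \<le> j" "j < 2 * n" and b: "b \<in> columns n (2 * n - r) \<times> columns n r"
    and c: "eop (ambient n r) j b = Some c"
  shows "c \<in> columns n (2 * n - r) \<times> columns n r \<and> letter_sum c < letter_sum b"
proof -
  obtain u v where b: "b = (u, v)" and u: "u \<in> columns n (2 * n - r)" and v: "v \<in> columns n r"
    using b by auto
  have less: "\<Sum> (set (replace (Suc j) j w)) < \<Sum> (set w)" if "can_e n j w" for w
  proof -
    have w: "Suc j \<in> set w" "j \<notin> set w" using that j by (auto simp: can_e_def src_def)
    have "\<Sum> (set w) = Suc j + \<Sum> (set w - {Suc j})" using w by (simp add: sum.remove)
    then show ?thesis using w by simp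
  qed
  have col: "replace (Suc j) j w \<in> columns n k" if "can_e n j w" "w \<in> columns n k" for w k
    using that j by (intro replace_columns) (auto simp: can_e_def src_def)
  have "src n j = j" using j by (simp add: src_def)
  then have "c = (replace (Suc j) j u, v) \<and> can_e n j u \<or> c = (u, replace (Suc j) j v) \<and> can_e n j v"
    using c ambient_ops(1)[OF j(2) u v] b by (auto split: if_splits)
  then show ?thesis
    using u v less col by (auto simp: b letter_sum_def)
qed

lemma virtual_e_letter_sum:
  assumes i: "1 \<le> i" "i \<le> n" and b: "b \<in> columns n (2 * n - r) \<times> columns n r"
    and c: "virtual_op n (eop (ambient n r)) i b = Some c"
  shows "letter_sum c < letter_sum b"
proof (cases "i < n")
  case True
  then obtain a where "eop (ambient n r) i b = Some a" "eop (ambient n r) (2 * n - i) a = Some c"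
    using c i by (auto simp: virtual_op_def bind_eq_Some_conv)
  then show ?thesis
    using ambient_e_letter_sum[of i n b r a] ambient_e_letter_sum[of "2 * n - i" n a r c] True i b
    by (auto simp: Suc_le_eq)
next
  case False
  then show ?thesis using ambient_e_letter_sum[of i n b r c] i b c by (auto simp: virtual_op_def)
qed

text \<open>If no raising operator applies, then after a \<open>Minus\<close> there can only be a \<open>Minus\<close>, and this would
  persist up to the last site, where \<open>e\<^sub>n\<close> applies. With \<open>Minus\<close> excluded, the same argument excludes
  \<open>Open\<close>: legality forbids a \<open>Hole\<close> after it, and \<open>e\<^sub>i\<close> applies to \<open>Open Plus\<close> and \<open>Open Close\<close>. A \<open>Close\<close>
  would then be unmatched, and a \<open>Plus\<close> cannot follow a \<open>Hole\<close>.\<close>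

lemma highest_site_sequence:
  assumes n: "1 \<le> n" and L: "legal n p"
    and e: "\<And>i. 1 \<le> i \<Longrightarrow> i < n \<Longrightarrow> e_pair (p i) (p (Suc i)) = None" and en: "e_last (p n) = None"
  obtains m where "m \<le> n" "\<forall>k\<in>{1..n}. p k = (if k \<le> m then Plus else Hole)"
proof -
  have minus: "p k \<noteq> Minus" if k: "1 \<le> k" "k \<le> n" for k
  proof
    assume "p k = Minus"
    have "p n = Minus" using k(2)
    proof (induction rule: dec_induct)
      case (step l)
      then show ?case using e[of l] k by (cases "p (Suc l)") auto
    qed fact
    then show False using en by (simp add: e_last_def)
  qed
  have op: "p k \<noteq> Open" if k: "1 \<le> k" "k \<le> n" for k
  proof
    assume "p k = Open"
    have "p n = Open" using k(2)
    proof (induction rule: dec_induct)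
      case (step l)
      then show ?case using e[of l] k legal_adjacent(2)[OF L, of l] minus[of "Suc l"]
        by (cases "p (Suc l)") auto
    qed fact
    then show False using en by (simp add: e_last_def)
  qed
  have h: "height p k = 0" if "k \<le> n" for k
    using that
  proof (induction k)
    case (Suc k)
    then show ?case using op[of "Suc k"] legal_nonneg[OF L, of "Suc k"]
      by (auto simp: bracket_def split: site.splits)
  qed simp
  have cl: "p k \<noteq> Close" if "1 \<le> k" "k \<le> n" for k
    using h[of k] h[of "k - 1"] that by (cases k) (auto simp: bracket_def)
  have ph: "p k \<in> {Plus, Hole}" if "1 \<le> k" "k \<le> n" for k
    using minus op cl that by (cases "p k") auto
  have hole: "p l = Hole" if "p k = Hole" "1 \<le> k" "k \<le> l" "l \<le> n" for k l
    using that(3,4)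
  proof (induction rule: dec_induct)
    case (step l)
    then show ?case using e[of l] ph[of "Suc l"] that(2) by auto
  qed (use that in simp)
  show ?thesis
  proof (cases "\<forall>k\<in>{1..n}. p k = Plus")
    case True
    then show ?thesis using that[of n] by auto
  next
    case False
    then obtain l where "l \<in> {1..n}" "p l \<noteq> Plus" by blast
    then have ex: "\<exists>k. k \<in> {1..n} \<and> p k = Hole" using ph[of l] by auto
    define k where "k = (LEAST k. k \<in> {1..n} \<and> p k = Hole)"
    have k: "k \<in> {1..n}" "p k = Hole" using LeastI_ex[OF ex] by (auto simp: k_def)
    have "p l = Plus" if "l \<in> {1..n}" "l < k" for l
      using not_less_Least[of l "\<lambda>k. k \<in> {1..n} \<and> p k = Hole"] that ph[of l] by (auto simp: k_def)
    moreover have "p l = Hole" if "l \<in> {1..n}" "k \<le> l" for l using hole[of k l] k that by auto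
    ultimately show ?thesis using that[of "k - 1"] k by auto
  qed
qed

lemma highest_is_top:
  assumes n: "1 \<le> n" and b: "b \<in> legal_pairs n r"
    and e: "\<And>i. 1 \<le> i \<Longrightarrow> i \<le> n \<Longrightarrow> virtual_op n (eop (ambient n r)) i b = None"
  shows "b = (top_column (2 * n - r), top_column r)"
proof -
  obtain u v p where b: "b = (u, v)" and L: "legal n p" and E: "encodes n r p u v"
    using b by (auto simp: legal_pairs_def)
  have "e_pair (p i) (p (Suc i)) = None" if i: "1 \<le> i" "i < n" for i
    using virtual_pair_step(2)[OF E i legal_adjacent[OF L i]] e[of i] i b
    by (cases "e_pair (p i) (p (Suc i))") auto
  moreover have "e_last (p n) = None"
    using virtual_last_step(2)[OF E n] e[of n] n b by (cases "e_last (p n)") auto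
  ultimately obtain m where m: "m \<le> n" "\<forall>k\<in>{1..n}. p k = (if k \<le> m then Plus else Hole)"
    using highest_site_sequence[OF n L] by blast
  have uv: "u = top_column (2 * n - m)" "v = top_column m"
    using encodes_unique[OF E encodes_top[OF m]] by simp_all
  moreover have "length v = r" using E by (simp add: encodes_def columns_def)
  ultimately have "m = r" by (simp add: top_column_def del: upt_Suc)
  then show ?thesis using uv b by simp
qed

lemma generated_mono: "b \<in> generated C I b0 \<Longrightarrow> I \<subseteq> J \<Longrightarrow> b \<in> generated C J b0"
  by (induction rule: generated.induct) (auto intro: generated.intros)

lemma virtual_sel [simp]:
  "eop (virtual n A) = virtual_op n (eop A)" "fop (virtual n A) = virtual_op n (fop A)"
  "wt (virtual n A) = virtual_wt n A"
  by (simp_all add: virtual_def)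

lemma top_in_legal_pairs: "r \<le> n \<Longrightarrow> (top_column (2 * n - r), top_column r) \<in> legal_pairs n r"
proof -
  assume r: "r \<le> n"
  let ?p = "\<lambda>k. if k \<le> r then Plus else Hole"
  have "height ?p k = 0" for k by (induction k) (auto simp: bracket_def)
  then have "legal n ?p" by (simp add: legal_def)
  then show ?thesis using encodes_top[OF r, of ?p] by (auto simp: legal_pairs_def)
qed

text \<open>Both index sets of interest are covered: with \<open>J = {0..n}\<close> the left side is \<open>V\<^bsup>r,1\<^esup>\<close>, with
  \<open>J = {1..n}\<close> it is the classical component of the generator. Connectedness only uses indices
  from \<open>{1..n}\<close>, closedness holds for all of \<open>{0..n}\<close>.\<close>

lemma generated_eq_legal_pairs:
  assumes n: "1 \<le> n" and r: "r \<le> n" and J: "{1..n} \<subseteq> J" "J \<subseteq> {0..n}"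
  shows "generated (virtual n (ambient n r)) J (top_column (2 * n - r), top_column r) = legal_pairs n r"
    (is "generated ?C J ?t = _")
proof
  show "generated ?C J ?t \<subseteq> legal_pairs n r"
  proof
    show "b \<in> legal_pairs n r" if "b \<in> generated ?C J ?t" for b
      using that
    proof (induction rule: generated.induct)
      case start
      show ?case by (rule top_in_legal_pairs[OF r])
    next
      case (eop b i c)
      have "i \<le> n" using eop.hyps(2) J(2) by auto
      then show ?case using legal_pairs_closed(2)[OF n eop.IH, of i c] eop.hyps(3) by simp
    next
      case (fop b i c)
      have "i \<le> n" using fop.hyps(2) J(2) by auto
      then show ?case using legal_pairs_closed(1)[OF n fop.IH, of i c] fop.hyps(3) by simp
    qed
  qed
  have "b \<in> generated ?C {1..n} ?t" if "b \<in> legal_pairs n r" for b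
    using that
  proof (induction "letter_sum b" arbitrary: b rule: less_induct)
    case less
    show ?case
    proof (cases "\<exists>i c. 1 \<le> i \<and> i \<le> n \<and> virtual_op n (eop (ambient n r)) i b = Some c")
      case True
      then obtain i c where i: "1 \<le> i" "i \<le> n" and c: "virtual_op n (eop (ambient n r)) i b = Some c"
        by blast
      have "b \<in> columns n (2 * n - r) \<times> columns n r"
        using less.prems by (auto simp: legal_pairs_def encodes_def)
      then have "letter_sum c < letter_sum b" by (rule virtual_e_letter_sum[OF i _ c])
      then have "c \<in> generated ?C {1..n} ?t"
        using less.hyps legal_pairs_closed(2)[OF n less.prems i(2) c] by blast
      then show ?thesis
      proof (rule generated.fop)
        show "i \<in> {1..n}" using i by simp
        show "fop ?C i c = Some b" using virtual_f_after_e[OF n less.prems i c] by simp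
      qed
    next
      case False
      have "virtual_op n (eop (ambient n r)) i b = None" if "1 \<le> i" "i \<le> n" for i
      proof (rule ccontr)
        assume "virtual_op n (eop (ambient n r)) i b \<noteq> None"
        then obtain c where "virtual_op n (eop (ambient n r)) i b = Some c" by blast
        then show False using False that by blast
      qed
      then have "b = ?t" by (rule highest_is_top[OF n less.prems])
      then show ?thesis by (simp only: generated.start)
    qed
  qed
  then show "legal_pairs n r \<subseteq> generated ?C J ?t" by (intro subsetI generated_mono[OF _ J(1)])
qed

section \<open>The isomorphism\<close>

lemma depth_map:
  assumes g: "\<And>b. b \<in> X \<Longrightarrow> g' (h b) = map_option h (g b)"
    and X: "\<And>b c. b \<in> X \<Longrightarrow> g b = Some c \<Longrightarrow> c \<in> X" and b: "b \<in> X"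
  shows "depth g' (h b) = depth g b"
proof -
  have "iter g' m (h b) = map_option h (iter g m b) \<and> (\<forall>c. iter g m b = Some c \<longrightarrow> c \<in> X)" for m
  proof (induction m)
    case (Suc m)
    then show ?case using g X by (cases "iter g m b") auto
  qed (simp add: b)
  then show ?thesis by (simp add: depth_def)
qed

lemma generated_image:
  assumes "\<And>b i. b \<in> generated C I b0 \<Longrightarrow> i \<in> I \<Longrightarrow> eop D i (h b) = map_option h (eop C i b)"
    and "\<And>b i. b \<in> generated C I b0 \<Longrightarrow> i \<in> I \<Longrightarrow> fop D i (h b) = map_option h (fop C i b)"
  shows "generated D I (h b0) = h ` generated C I b0"
proof (intro equalityI subsetI)
  show "c \<in> h ` generated C I b0" if "c \<in> generated D I (h b0)" for c
    using that
  proof (induction rule: generated.induct)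
    case (eop b i c)
    then show ?case using assms(1) by (auto intro!: imageI intro: generated.eop)
  next
    case (fop b i c)
    then show ?case using assms(2) by (auto intro!: imageI intro: generated.fop)
  qed (auto intro: generated.start)
  have "h b \<in> generated D I (h b0)" if "b \<in> generated C I b0" for b
    using that
  proof (induction rule: generated.induct)
    case (eop b i c)
    then show ?case using assms(1)[OF eop(1,2)] by (auto intro: generated.eop)
  next
    case (fop b i c)
    then show ?case using assms(2)[OF fop(1,2)] by (auto intro: generated.fop)
  qed (rule generated.start)
  then show "c \<in> generated D I (h b0)" if "c \<in> h ` generated C I b0" for c
    using that by auto
qed

lemma virtual_op_map:
  assumes g: "\<And>j b. j \<in> {1..2 * n - 1} \<Longrightarrow> b \<in> X \<Longrightarrow> g' j (h b) = map_option h (g j b)"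
    and X: "\<And>j b c. j \<in> {1..2 * n - 1} \<Longrightarrow> b \<in> X \<Longrightarrow> g j b = Some c \<Longrightarrow> c \<in> X"
    and i: "i \<in> {1..n}" and b: "b \<in> X"
  shows "virtual_op n g' i (h b) = map_option h (virtual_op n g i b)"
proof -
  have i2: "i \<in> {1..2 * n - 1}" using i by auto
  show ?thesis
  proof (cases "i < n")
    case True
    then have "2 * n - i \<in> {1..2 * n - 1}" using i by auto
    then show ?thesis using g[OF i2 b] X[OF i2 b] g True i
      by (cases "g i b") (auto simp: virtual_op_def)
  next
    case False
    then show ?thesis using g[OF i2 b] i by (auto simp: virtual_op_def)
  qed
qed

text \<open>For nonzero indices the operators on columns are those on words, so concatenating the columns is
  an instance of associativity.\<close>

lemma ambient_tableau_ops:
  assumes j: "j \<in> {1..2 * n - 1}" and r: "r \<le> n"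
    and b: "b \<in> {(u, v). length u = 2 * n - r \<and> length v = r}"
  shows "eop (tableau_crystal n r) j (case_prod append b) =
      map_option (case_prod append) (eop (ambient n r) j b)"
    "fop (tableau_crystal n r) j (case_prod append b) =
      map_option (case_prod append) (fop (ambient n r) j b)"
    "eop (ambient n r) j b = Some c \<Longrightarrow> c \<in> {(u, v). length u = 2 * n - r \<and> length v = r}"
    "fop (ambient n r) j b = Some c \<Longrightarrow> c \<in> {(u, v). length u = 2 * n - r \<and> length v = r}"
proof -
  obtain u v where b: "b = (u, v)" and u: "length u = 2 * n - r" and v: "length v = r"
    using b by auto
  have "j \<noteq> 0" using j by auto
  then have ops: "eop (column_crystal n k) j = eop (words n k) j"
    "fop (column_crystal n k) j = fop (words n k) j" for k
    by (auto simp: column_crystal_def)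
  have st: "epsilon (column_crystal n (2 * n - r)) j u = weps j u"
    "phi (column_crystal n r) j v = wphi j v"
    using epsilon_phi_words[OF j u] epsilon_phi_words[OF j v] by (simp_all add: epsilon_def phi_def ops)
  have "2 * n - r + r = 2 * n" using r by simp
  note app = word_ops_append[OF j v u, unfolded this]
  show "eop (tableau_crystal n r) j (case_prod append b) =
      map_option (case_prod append) (eop (ambient n r) j b)"
    "fop (tableau_crystal n r) j (case_prod append b) =
      map_option (case_prod append) (fop (ambient n r) j b)"
    by (simp_all add: b app tableau_crystal_def ambient_def tensor_def st ops option.map_comp o_def)
  have len: "length x = k" if "length w = k" "eop (words n k) j w = Some x \<or> fop (words n k) j w = Some x" for w x k
    using seminormal_onD(3,4)[OF seminormal_on_words[OF j, of k], of w] that by blast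
  show "eop (ambient n r) j b = Some c \<Longrightarrow> c \<in> {(u, v). length u = 2 * n - r \<and> length v = r}"
    "fop (ambient n r) j b = Some c \<Longrightarrow> c \<in> {(u, v). length u = 2 * n - r \<and> length v = r}"
    using u v len[OF u] len[OF v] by (auto simp: b ambient_def tensor_def ops split: if_splits)
qed

lemma wt_ambient_tableau:
  assumes "r \<le> n" "length u = 2 * n - r" "length v = r"
  shows "wt (tableau_crystal n r) (u @ v) = wt (ambient n r) (u, v)"
  using assms by (auto simp: tableau_crystal_def ambient_def tensor_def column_crystal_def wt_words)

lemma wt_column:
  assumes "w \<in> columns n k"
  shows "wt (column_crystal n k) w j =
    (if j \<in> {1..2 * n - 1} then of_bool (j \<in> set w) - of_bool (Suc j \<in> set w) else 0)"
proof -
  have "(\<Sum>a\<leftarrow>w. wt (letters n) a j) =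
    (if j \<in> {1..2 * n - 1} then of_bool (j \<in> set w) - of_bool (Suc j \<in> set w) else 0)"
    using columns_distinct[OF assms] by (induction w) (auto simp: letters_def)
  then show ?thesis using assms by (simp add: column_crystal_def columns_def wt_words)
qed

text \<open>The image of \<open>\<Psi>\<close> consists of the weights supported on \<open>{1..2n - 1}\<close> that are symmetric under \<open>j \<mapsto> 2n - j\<close>.\<close>

lemma Psi_eq:
  "Psi n \<nu> j = (if j \<in> {1..n} then \<nu> j else if j \<in> {n<..2 * n - 1} then \<nu> (2 * n - j) else 0)"
proof -
  let ?k = "if j \<le> n then j else 2 * n - j"
  have "Psi n \<nu> j = (\<Sum>i = 1..n. if i = ?k \<and> j < 2 * n then \<nu> i else 0)"
    unfolding Psi_def by (intro sum.cong) (auto simp: fund_def)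
  then show ?thesis by (cases "j < 2 * n") auto
qed

text \<open>If \<open>c x\<close> counts the occurrences of \<open>x\<close>, then \<open>c k + c (2n + 1 - k) = 2\<close> at each of the five sites, and
  the weight, given by the differences \<open>c j - c (j + 1)\<close>, is symmetric under \<open>j \<mapsto> 2n - j\<close>.\<close>

lemma legal_pairs_virtual_wt:
  assumes b: "b \<in> legal_pairs n r"
  shows "\<exists>\<nu>. virtual_wt n (ambient n r) b = Some \<nu>"
proof -
  obtain u v p where b: "b = (u, v)" and E: "encodes n r p u v"
    using b by (auto simp: legal_pairs_def)
  let ?w = "wt (ambient n r) b"
  define c :: "nat \<Rightarrow> int" where "c x = of_bool (x \<in> set u) + of_bool (x \<in> set v)" for x
  have w: "?w j = (if j \<in> {1..2 * n - 1} then c j - c (Suc j) else 0)" for j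
    using E by (simp add: b ambient_def tensor_def wt_column encodes_def c_def)
  have c: "c k + c (2 * n + 1 - k) = 2" if "k \<in> {1..n}" for k
  proof -
    have "site_at n u v k (p k)" using E that by (simp add: encodes_def)
    then show ?thesis by (cases "p k") (simp_all add: site_at_def c_def)
  qed
  have sym: "?w j = ?w (2 * n - j)" if j: "j \<in> {n<..2 * n - 1}" for j
  proof -
    define k where "k = 2 * n - j"
    have k: "k \<in> {1..n}" "Suc k \<in> {1..n}" "2 * n + 1 - k = Suc j" "2 * n + 1 - Suc k = j"
      "k \<in> {1..2 * n - 1}" "j \<in> {1..2 * n - 1}"
      using j by (auto simp: k_def)
    have "c k + c (Suc j) = 2" "c (Suc k) + c j = 2" using c[OF k(1)] c[OF k(2)] k(3,4) by simp_all
    then show ?thesis unfolding k_def[symmetric] w using k(5,6) by simp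
  qed
  let ?\<nu> = "\<lambda>j. if j \<in> {1..n} then ?w j else 0"
  have B: "?\<nu> \<in> B_weights n" by (simp add: B_weights_def)
  have P: "Psi n ?\<nu> = ?w"
  proof
    fix j
    show "Psi n ?\<nu> j = ?w j"
      using sym[of j] w[of j] by (auto simp: Psi_eq)
  qed
  have "\<exists>!\<nu>. \<nu> \<in> B_weights n \<and> Psi n \<nu> = ?w"
    using B P Psi_inj by (intro ex1I[of _ ?\<nu>]) (blast, metis)
  then show ?thesis by (simp add: virtual_wt_def)
qed

theorem theorem6p27:
  fixes n r :: nat
  assumes "1 \<le> n" and "1 \<le> r" and "r \<le> n"
  shows "aligned n (ambient n r) (carrier (V_aff n r)) \<and>
    B_crystals_isomorphic n (V_aff n r) (V_fin n r)"
proof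
  let ?A = "virtual n (ambient n r)" and ?T = "virtual n (tableau_crystal n r)"
  let ?t = "(top_column (2 * n - r), top_column r)"
  let ?h = "case_prod append :: nat list \<times> nat list \<Rightarrow> nat list"
  let ?X = "{(u, v). length u = 2 * n - r \<and> length v = r} :: (nat list \<times> nat list) set"
  have gen: "generated ?A {0..n} ?t = legal_pairs n r" "generated ?A {1..n} ?t = legal_pairs n r"
    by (rule generated_eq_legal_pairs[OF assms(1,3)]; auto)+
  have aff: "carrier (V_aff n r) = legal_pairs n r" by (simp add: V_aff_def gen)
  then show "aligned n (ambient n r) (carrier (V_aff n r))"
    using legal_pairs_aligned[OF assms(1)] by simp
  have X: "legal_pairs n r \<subseteq> ?X" by (auto simp: legal_pairs_def encodes_def columns_def)
  note T = ambient_tableau_ops[OF _ assms(3)]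
  have e: "eop ?T i (?h b) = map_option ?h (eop ?A i b)" and f: "fop ?T i (?h b) = map_option ?h (fop ?A i b)"
    if "i \<in> {1..n}" "b \<in> legal_pairs n r" for i b
  proof -
    have b: "b \<in> ?X" using X that(2) by blast
    show "eop ?T i (?h b) = map_option ?h (eop ?A i b)"
      unfolding virtual_sel
      by (rule virtual_op_map[where X = ?X, OF _ _ that(1) b]; (rule T(1) T(3); assumption))
    show "fop ?T i (?h b) = map_option ?h (fop ?A i b)"
      unfolding virtual_sel
      by (rule virtual_op_map[where X = ?X, OF _ _ that(1) b]; (rule T(2) T(4); assumption))
  qed
  have "generated ?T {1..n} (?h ?t) = ?h ` legal_pairs n r"
    using generated_image[of ?A "{1..n}" ?t ?T ?h] e f unfolding gen by blast
  then have fin: "carrier (V_fin n r) = ?h ` legal_pairs n r" by (simp add: V_fin_def)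
  have ops: "eop (V_aff n r) = eop ?A" "fop (V_aff n r) = fop ?A" "wt (V_aff n r) = wt ?A"
    "eop (V_fin n r) = eop ?T" "fop (V_fin n r) = fop ?T" "wt (V_fin n r) = wt ?T"
    by (simp_all add: V_aff_def V_fin_def)
  have "B_crystal_iso n (V_aff n r) (V_fin n r) ?h"
    unfolding B_crystal_iso_def aff fin
  proof (intro conjI ballI)
    show "bij_betw ?h (legal_pairs n r) (?h ` legal_pairs n r)"
    proof (intro inj_on_imp_bij_betw inj_onI)
      fix b c assume "b \<in> legal_pairs n r" "c \<in> legal_pairs n r" "?h b = ?h c"
      moreover have "b \<in> ?X" "c \<in> ?X" using calculation X by blast+
      ultimately show "b = c" by (cases b; cases c) simp
    qed
  next
    fix b assume b: "b \<in> legal_pairs n r"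
    then have "wt (tableau_crystal n r) (?h b) = wt (ambient n r) b"
      using X wt_ambient_tableau[OF assms(3)] by auto
    then have "virtual_wt n (tableau_crystal n r) (?h b) = virtual_wt n (ambient n r) b"
      by (simp add: virtual_wt_def)
    then show "\<exists>\<nu>. wt (V_aff n r) b = Some \<nu> \<and> wt (V_fin n r) (?h b) = Some \<nu>"
      using legal_pairs_virtual_wt[OF b] by (simp add: ops)
    fix i assume i: "i \<in> {1..n}"
    then have "i \<le> n" by simp
    note closed = legal_pairs_closed[OF assms(1) _ this]
    show "eop (V_fin n r) i (?h b) = map_option ?h (eop (V_aff n r) i b)"
      "fop (V_fin n r) i (?h b) = map_option ?h (fop (V_aff n r) i b)"
      unfolding ops by (rule e[OF i b] f[OF i b])+
    have "depth (eop ?T i) (?h b) = depth (eop ?A i) b"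
      by (rule depth_map[of "legal_pairs n r" _ ?h]) (use e[OF i] closed(2) b in simp_all)
    then show "epsilon (V_fin n r) i (?h b) = epsilon (V_aff n r) i b"
      by (simp add: epsilon_def ops)
    have "depth (fop ?T i) (?h b) = depth (fop ?A i) b"
      by (rule depth_map[of "legal_pairs n r" _ ?h]) (use f[OF i] closed(1) b in simp_all)
    then show "phi (V_fin n r) i (?h b) = phi (V_aff n r) i b"
      by (simp add: phi_def ops)
  qed
  then show "B_crystals_isomorphic n (V_aff n r) (V_fin n r)"
    unfolding B_crystals_isomorphic_def by blast
qed

end
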